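(* Let $p_1,\dots,p_k$ be distinct primes and $\alpha_1,\dots,\alpha_k$ positive integers such that $n=\prod_{i=1}^k p_i^{\alpha_i}\equiv 1\pmod 6$, where $\alpha_i$ is even whenever $p_i\equiv 5\pmod 6$ and $\alpha_i$ is an arbitrary positive integer whenever $p_i\equiv 1\pmod 6$. Then $$r_{1,3}(n)=\sum_{i=1}^{k}\Big(\prod_{j=i+1}^{k}\sigma_1(p_j^{\alpha_j})\Big)\Big(\prod_{j=1}^{i-1}a_{p_j^{\alpha_j}}\Big)\, r_{1,3}(p_i^{\alpha_i}),$$ where $a_\ell$ is the $\ell$-th Fourier coefficient of the cusp form $\eta(6\tau)^4$.
   Context: $r_{1,3}(n)$ is the number of $\vec{x}\in\mathbb{Z}^4$ with $x_1^2+x_2^2+x_3^2+x_4^2=n$ and $x_i\equiv1\pmod3$ for all $i$. $\sigma_1(m)=\sum_{d\mid m}d$. $\eta(\tau)=q^{1/24}\prod_{n\ge1}(1-q^n)$ with $q=e^{2\pi i\tau}$, and $\eta(6\tau)^4=\sum_{\ell\ge1}a_\ell q^\ell$. Empty products equal $1$. *)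

theory Defs
  imports "HOL-Complex_Analysis.Complex_Analysis" "HOL-Number_Theory.Number_Theory"
begin

text \<open>Otherwise \<open>$\<close> is ambiguous between \<open>fps_nth\<close> and \<open>vec_nth\<close>.\<close>

no_notation fps_nth (infixl "$" 75)

definition r13 :: "nat \<Rightarrow> nat" where
  "r13 n = card {x :: int ^ 4. (\<Sum>i\<in>UNIV. (x $ i)\<^sup>2) = int n \<and> (\<forall>i. [x $ i = 1] (mod 3))}"

text \<open>Meaningful for \<open>m > 0\<close>; for \<open>m = 0\<close> the index set is infinite and the value is 0.\<close>

definition sigma1 :: "nat \<Rightarrow> nat" where
  "sigma1 m = (\<Sum>d | d dvd m. d)"

definition qpar :: "complex \<Rightarrow> complex" where
  "qpar \<tau> = exp (2 * of_real pi * \<i> * \<tau>)"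

text \<open>The factor \<open>q\<^sup>1\<^sup>/\<^sup>2\<^sup>4\<close> means \<open>exp (2 \<pi> \<i> \<tau> / 24)\<close>,
  not the principal 24th root of \<open>q\<close>.\<close>

definition dedekind_eta :: "complex \<Rightarrow> complex" where
  "dedekind_eta \<tau> = exp (2 * of_real pi * \<i> * \<tau> / 24) * (\<Prod>n. 1 - qpar \<tau> ^ Suc n)"

text \<open>The expansion starts at \<open>l = 0\<close>; for \<open>\<eta>(6\<tau>)\<^sup>4\<close>, which vanishes at the cusp,
  uniqueness forces the coefficient at \<open>l = 0\<close> to be 0. Existence and uniqueness of the
  coefficients of \<open>\<eta>(6\<tau>)\<^sup>4\<close> are proved below, so \<open>THE\<close> denotes the intended sequence.\<close>

definition has_q_expansion :: "(complex \<Rightarrow> complex) \<Rightarrow> (nat \<Rightarrow> complex) \<Rightarrow> bool" where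
  "has_q_expansion f a \<longleftrightarrow> (\<forall>\<tau>. Im \<tau> > 0 \<longrightarrow> (\<lambda>l. a l * qpar \<tau> ^ l) sums f \<tau>)"

definition fourier_coeff :: "(complex \<Rightarrow> complex) \<Rightarrow> nat \<Rightarrow> complex" where
  "fourier_coeff f = (THE a. has_q_expansion f a)"

definition eta6_coeff :: "nat \<Rightarrow> complex" where
  "eta6_coeff = fourier_coeff (\<lambda>\<tau>. dedekind_eta (6 * \<tau>) ^ 4)"


text \<open>The set counted by \<open>r13\<close> is finite, and \<open>eta6_coeff\<close> is well defined.\<close>

lemma finite_r13:
  "finite {x :: int ^ 4. (\<Sum>i\<in>UNIV. (x $ i)\<^sup>2) = int n \<and> (\<forall>i. [x $ i = 1] (mod 3))}"
  (is "finite ?A")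
proof -
  have "x $ i \<in> {- int n..int n}" if "x \<in> ?A" for x i
  proof -
    have "(x $ i)\<^sup>2 \<le> (\<Sum>i\<in>UNIV. (x $ i)\<^sup>2)"
      by (rule member_le_sum) auto
    hence "(x $ i)\<^sup>2 \<le> int n" using that by simp
    moreover have "\<bar>x $ i\<bar> \<le> (x $ i)\<^sup>2"
      using self_le_power[of "\<bar>x $ i\<bar>" 2] by (cases "x $ i = 0") auto
    ultimately show ?thesis by auto
  qed
  hence "vec_nth ` ?A \<subseteq> PiE UNIV (\<lambda>_. {- int n..int n})"
    by auto
  hence "finite (vec_nth ` ?A)"
    by (rule finite_subset) (auto intro: finite_PiE)
  thus ?thesis
    by (rule finite_imageD) (auto simp: inj_on_def vec_eq_iff)
qed

lemma holomorphic_euler_prod: "(\<lambda>q. \<Prod>n. 1 - q ^ Suc n :: complex) holomorphic_on ball 0 1"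
proof (rule holomorphic_uniform_sequence[where f = "\<lambda>N q. \<Prod>n<N. 1 - q ^ Suc n"])
  fix x :: complex assume "x \<in> ball 0 1"
  then obtain d where d: "d > 0" "cball x d \<subseteq> ball 0 1"
    using open_contains_cball open_ball by meson
  have "compact (norm ` cball x d)"
    by (intro compact_continuous_image continuous_intros) auto
  then obtain r where r: "r \<in> norm ` cball x d" "\<And>y. y \<in> norm ` cball x d \<Longrightarrow> y \<le> r"
    using compact_attains_sup[of "norm ` cball x d"] d by force
  have r01: "0 \<le> r" "r < 1"
    using r(1) d(2) by auto
  have "uniformly_convergent_on (cball x d) (\<lambda>N q. \<Prod>n<N. 1 - q ^ Suc n)"
  proof (rule uniformly_convergent_on_prod')
    show "uniformly_convergent_on (cball x d) (\<lambda>N q. \<Sum>n<N. norm (1 - q ^ Suc n - 1))"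
    proof (rule Weierstrass_m_test'[where M = "\<lambda>n. r ^ Suc n"])
      show "summable (\<lambda>n. r ^ Suc n)"
        using r01 summable_geometric[of r] by (subst summable_Suc_iff) auto
    next
      fix n y assume "y \<in> cball x d"
      hence "norm y \<le> r" using r(2) by blast
      hence "norm y ^ Suc n \<le> r ^ Suc n" by (intro power_mono) auto
      thus "norm (norm (1 - y ^ Suc n - 1)) \<le> r ^ Suc n"
        by (simp add: norm_power norm_mult)
    qed
  qed (auto intro!: continuous_intros)
  then obtain g where g: "uniform_limit (cball x d) (\<lambda>N q. \<Prod>n<N. 1 - q ^ Suc n) g sequentially"
    by (auto simp: uniformly_convergent_on_def)
  have "g q = (\<Prod>n. 1 - q ^ Suc n)" if q: "q \<in> cball x d" for q
  proof -
    have "norm q < 1" using q d(2) by auto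
    hence "summable (\<lambda>n. norm (1 - q ^ Suc n - 1))"
      using summable_geometric[of "norm q"]
      by (simp add: norm_power norm_mult summable_mult)
    hence "convergent_prod (\<lambda>n. 1 - q ^ Suc n)"
      by (intro abs_convergent_prod_imp_convergent_prod summable_imp_abs_convergent_prod)
    hence "(\<lambda>N. \<Prod>n\<le>N. 1 - q ^ Suc n) \<longlonglongrightarrow> (\<Prod>n. 1 - q ^ Suc n)"
      by (rule convergent_prod_LIMSEQ)
    moreover have "(\<lambda>N. \<Prod>n<Suc N. 1 - q ^ Suc n) \<longlonglongrightarrow> g q"
      using tendsto_uniform_limitI[OF g q] by (rule LIMSEQ_Suc)
    ultimately show ?thesis
      unfolding lessThan_Suc_atMost using LIMSEQ_unique by blast
  qed
  hence "uniform_limit (cball x d) (\<lambda>N q. \<Prod>n<N. 1 - q ^ Suc n) (\<lambda>q. \<Prod>n. 1 - q ^ Suc n) sequentially"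
    using g uniform_limit_cong'[of "cball x d" "\<lambda>N q. \<Prod>n<N. 1 - q ^ Suc n"
        "\<lambda>N q. \<Prod>n<N. 1 - q ^ Suc n" g "\<lambda>q. \<Prod>n. 1 - q ^ Suc n" sequentially]
    by blast
  thus "\<exists>d>0. cball x d \<subseteq> ball 0 1 \<and>
      uniform_limit (cball x d) (\<lambda>N q. \<Prod>n<N. 1 - q ^ Suc n) (\<lambda>q. \<Prod>n. 1 - q ^ Suc n) sequentially"
    using d by blast
qed (auto intro!: holomorphic_intros)

lemma has_q_expansion_unique:
  assumes "has_q_expansion f a" "has_q_expansion f b"
  shows "a = b"
proof -
  have *: "(\<lambda>n. (a n - b n) * z ^ n) sums 0" if z: "z \<noteq> 0" "norm z < 1" for z
  proof -
    define \<tau> where "\<tau> = Ln z / (2 * of_real pi * \<i>)"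
    have "qpar \<tau> = z" using z by (simp add: qpar_def \<tau>_def)
    moreover have "Im \<tau> > 0"
    proof -
      have "\<tau> = - \<i> * Ln z / of_real (2 * pi)"
        by (simp add: \<tau>_def field_simps)
      hence "Im \<tau> = - Re (Ln z) / (2 * pi)" by (simp only: Im_divide_of_real) simp
      thus ?thesis using z by (simp add: divide_less_0_iff)
    qed
    ultimately have "(\<lambda>n. a n * z ^ n) sums f \<tau>" "(\<lambda>n. b n * z ^ n) sums f \<tau>"
      using assms unfolding has_q_expansion_def by auto
    from sums_diff[OF this] show ?thesis by (simp add: algebra_simps)
  qed
  define F where "F = Abs_fps (\<lambda>n. a n - b n)"
  have sumsF: "eval_fps F z = 0" if "z \<noteq> 0" "norm z < 1" for z
    using sums_unique[OF *[OF that]] by (simp add: F_def eval_fps_def)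
  have "summable (\<lambda>n. (a n - b n) * (1 / 2) ^ n)"
    by (rule sums_summable[OF *]) (auto simp: norm_divide)
  hence "norm (1/2::complex) \<le> fps_conv_radius F"
    unfolding fps_conv_radius_def F_def fps_nth_Abs_fps by (rule conv_radius_geI)
  moreover have "0 < ereal (norm (1/2::complex))"
    by (simp add: norm_divide)
  ultimately have R: "fps_conv_radius F > 0"
    by (rule less_le_trans[rotated])
  have "continuous (at 0) (eval_fps F)"
    using R by (intro continuous_eval_fps) (auto simp: zero_ereal_def)
  hence "eval_fps F \<midarrow>0\<rightarrow> eval_fps F 0" by (simp add: continuous_at)
  moreover have "eventually (\<lambda>z. eval_fps F z = 0) (at (0::complex))"
    unfolding eventually_at using sumsF by (intro exI[of _ 1]) auto
  hence "eval_fps F \<midarrow>0\<rightarrow> 0" by (rule tendsto_eventually)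
  ultimately have F0: "eval_fps F 0 = 0" using LIM_unique by blast
  have "eventually (\<lambda>z::complex. z \<in> ball 0 1) (nhds 0)"
    by (intro eventually_nhds_in_open) auto
  hence ev: "eventually (\<lambda>z. eval_fps F z = eval_fps 0 z) (nhds 0)"
  proof eventually_elim
    case (elim z)
    thus ?case using sumsF[of z] F0 by (cases "z = 0") auto
  qed
  have "F = 0"
    by (rule eval_fps_eqD[OF R _ ev]) simp
  hence "a n - b n = 0" for n
    by (metis F_def fps_nth_Abs_fps fps_zero_nth)
  thus ?thesis by auto
qed

lemma has_q_expansion_fourier_coeff:
  assumes "has_q_expansion f a"
  shows "fourier_coeff f = a"
  unfolding fourier_coeff_def using assms has_q_expansion_unique by blast

lemma has_q_expansion_eta6: "has_q_expansion (\<lambda>\<tau>. dedekind_eta (6 * \<tau>) ^ 4) eta6_coeff"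
  and eta6_coeff_0: "eta6_coeff 0 = 0"
proof -
  define g where "g = (\<lambda>q::complex. q * (\<Prod>n. 1 - (q ^ 6) ^ Suc n) ^ 4)"
  have hol: "g holomorphic_on ball 0 1"
    unfolding g_def
    by (intro holomorphic_intros holomorphic_on_compose_gen[OF _ holomorphic_euler_prod, unfolded o_def])
       (auto simp: norm_power power_less_one_iff)
  have "dedekind_eta (6 * \<tau>) ^ 4 = g (qpar \<tau>)" for \<tau>
  proof -
    have "qpar (6 * \<tau>) = qpar \<tau> ^ 6"
      unfolding qpar_def by (subst exp_of_nat_mult[symmetric]) (simp add: mult_ac)
    moreover have "exp (2 * of_real pi * \<i> * (6 * \<tau>) / 24) ^ 4 = qpar \<tau>"
      unfolding qpar_def by (subst exp_of_nat_mult[symmetric]) (simp add: mult_ac)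
    ultimately show ?thesis
      by (simp only: dedekind_eta_def g_def power_mult_distrib)
  qed
  moreover have "qpar \<tau> \<in> ball 0 1" if "Im \<tau> > 0" for \<tau>
    using that by (simp add: qpar_def)
  ultimately have *: "has_q_expansion (\<lambda>\<tau>. dedekind_eta (6 * \<tau>) ^ 4) (\<lambda>n. (deriv ^^ n) g 0 / fact n)"
    using holomorphic_power_series[OF hol] by (simp add: has_q_expansion_def)
  have eq: "eta6_coeff = (\<lambda>n. (deriv ^^ n) g 0 / fact n)"
    unfolding eta6_coeff_def using * by (rule has_q_expansion_fourier_coeff)
  show "has_q_expansion (\<lambda>\<tau>. dedekind_eta (6 * \<tau>) ^ 4) eta6_coeff"
    unfolding eq by (rule *)
  show "eta6_coeff 0 = 0"
    by (simp add: eq g_def)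
qed

end

theory Submission
  imports Defs
begin

text \<open>
  Let \<open>c\<^sub>j(n)\<close> count the Hurwitz quaternions of norm \<open>n\<close> that are congruent to 1 modulo 3 and map to
  \<open>\<omega>\<^sup>j\<close> in the residue field \<open>F\<^sub>4\<close> at the prime above 2; conjugation gives \<open>c\<^sub>1 = c\<^sub>2\<close>.
  For \<open>n \<equiv> 1 (mod 6)\<close>, multiplication by a unit turns the vectors counted by \<open>r\<^sub>1\<^sub>,\<^sub>3(n)\<close> into
  those counted by \<open>c\<^sub>2(n)\<close>. Euler's pentagonal number theorem writes the coefficient \<open>a\<^sub>n\<close> as a signed
  count of solutions of \<open>\<Sum> (6 k\<^sub>i + 1)\<^sup>2 = 4 n\<close>, which becomes \<open>c\<^sub>0(n) - c\<^sub>1(n)\<close>. Jacobi's theorem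
  on four odd squares becomes \<open>\<sigma>\<^sub>1(n) = c\<^sub>0(n) + c\<^sub>1(n) + c\<^sub>2(n)\<close>. Unique factorization of a
  quaternion of norm \<open>m n\<close>, with \<open>m\<close> and \<open>n\<close> coprime, shows that the \<open>c\<^sub>j\<close> multiply like elements of
  the group ring of \<open>Z/3\<close>. Hence \<open>a\<close> is multiplicative and
  \<open>r\<^sub>1\<^sub>,\<^sub>3(m n) = r\<^sub>1\<^sub>,\<^sub>3(m) \<sigma>\<^sub>1(n) + a\<^sub>m r\<^sub>1\<^sub>,\<^sub>3(n)\<close>, from which the formula follows by induction.
\<close>

subsection \<open>Sums of four odd squares\<close>

text \<open>For fixed odd \<open>u\<close> the pairs \<open>(d, e)\<close> are the factorizations of
  \<open>(M - u\<^sup>2) / 4\<close> into odd positive factors, so sums over this set are divisor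
  sums accumulated over \<open>u\<close>.\<close>

definition liouville_set :: "int \<Rightarrow> (int \<times> int \<times> int) set" where
  "liouville_set M = {(u, d, e). odd u \<and> odd d \<and> odd e \<and> d > 0 \<and> e > 0 \<and> u\<^sup>2 + 4 * d * e = M}"

lemma abs_le_of_square_le:
  fixes x :: int
  assumes "x\<^sup>2 \<le> m"
  shows "\<bar>x\<bar> \<le> m"
proof -
  have "\<bar>x\<bar> \<le> x\<^sup>2"
    using self_le_power[of "\<bar>x\<bar>" 2] by (cases "x = 0") auto
  with assms show ?thesis by linarith
qed

lemma finite_liouville_set: "finite (liouville_set M)"
proof (rule finite_subset)
  show "liouville_set M \<subseteq> {-M..M} \<times> {0..M} \<times> {0..M}"
  proof
    fix x assume "x \<in> liouville_set M"
    then obtain u d e where x: "x = (u, d, e)" and *: "d > 0" "e > 0" "u\<^sup>2 + 4 * (d * e) = M"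
      by (auto simp: liouville_set_def)
    have de: "d \<le> d * e" "e \<le> d * e" "0 < d * e" "0 \<le> u\<^sup>2"
      using *(1,2) by (simp_all add: mult_le_cancel_left1 mult_le_cancel_right1)
    have "u\<^sup>2 \<le> M" using de * by linarith
    then have "\<bar>u\<bar> \<le> M" by (rule abs_le_of_square_le)
    moreover have "d \<le> M" "e \<le> M" using de * by linarith+
    ultimately show "x \<in> {-M..M} \<times> {0..M} \<times> {0..M}"
      using *(1,2) by (simp add: x abs_le_iff)
  qed
qed simp

text \<open>A Liouville-type identity. Subtracting the term \<open>u d\<^sup>2\<close>, which is odd in \<open>u\<close>, and folding the
  part \<open>e < u + d\<close> onto the part \<open>A\<close> where \<open>e > u + d\<close> turns the summand into
  \<open>(d + e) (d + u) (e - u)\<close>, which an involution of \<open>A\<close> negates.\<close>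

lemma liouville_sum:
  "(\<Sum>(u, d, e)\<in>liouville_set M. d * (d * e - u\<^sup>2)) = 0"
proof -
  let ?\<Omega> = "liouville_set M"
  define F where "F = (\<lambda>(u, d, e). d * (d * e - u\<^sup>2) - u * d\<^sup>2 :: int)"
  define A where "A = {(u, d, e) \<in> ?\<Omega>. e > u + d}"
  define C where "C = {(u, d, e) \<in> ?\<Omega>. e < u + d}"
  define G where "G = (\<lambda>(u, d, e). (d + e) * (d + u) * (e - u) :: int)"
  have fin: "finite A" "finite C"
    unfolding A_def C_def by (auto intro: finite_subset[OF _ finite_liouville_set])
  have "(\<Sum>(u, d, e)\<in>?\<Omega>. u * d\<^sup>2) = (\<Sum>(u, d, e)\<in>?\<Omega>. - (u * d\<^sup>2))"
    by (rule sum.reindex_bij_witness[where i = "\<lambda>(u, d, e). (-u, d, e)" and j = "\<lambda>(u, d, e). (-u, d, e)"])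
       (auto simp: liouville_set_def)
  hence odd0: "(\<Sum>(u, d, e)\<in>?\<Omega>. u * d\<^sup>2) = 0"
    by (simp add: case_prod_unfold sum_negf)
  have "(\<Sum>(u, d, e)\<in>?\<Omega>. d * (d * e - u\<^sup>2)) = sum F ?\<Omega> + (\<Sum>(u, d, e)\<in>?\<Omega>. u * d\<^sup>2)"
    by (simp add: F_def case_prod_unfold sum_subtractf)
  also have "\<dots> = sum F ?\<Omega>" using odd0 by simp
  also have \<Omega>: "?\<Omega> = A \<union> C"
  proof -
    have "e \<noteq> u + d" if "(u, d, e) \<in> ?\<Omega>" for u d e
      using that unfolding liouville_set_def by auto
    thus ?thesis unfolding A_def C_def by force
  qed
  also have "sum F (A \<union> C) = sum F A + sum F C"
    using fin by (intro sum.union_disjoint) (auto simp: A_def C_def)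
  also have "sum F C = (\<Sum>(u, d, e)\<in>A. F (-u, e, d))"
    by (rule sum.reindex_bij_witness[where i = "\<lambda>(u, d, e). (-u, e, d)" and j = "\<lambda>(u, d, e). (-u, e, d)"])
       (auto simp: A_def C_def liouville_set_def)
  also have "sum F A + \<dots> = sum G A"
    unfolding sum.distrib[symmetric]
    by (rule sum.cong) (auto simp: F_def G_def algebra_simps power2_eq_square)
  also have "sum G A = 0"
  proof -
    \<comment> \<open>Shifting \<open>u\<close> by \<open>2 * d\<close> preserves
      \<open>u\<^sup>2 + 4 * d * e\<close> once \<open>e\<close> becomes \<open>e - u - d\<close>,
      which is positive exactly on \<open>A\<close>. With the sign of the shifted \<open>u\<close>
      reversed this is an involution that exchanges \<open>d + e\<close> with \<open>e - u\<close>
      and negates \<open>d + u\<close>.\<close>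
    have "sum G A = (\<Sum>x\<in>A. - G x)"
      by (rule sum.reindex_bij_witness[where i = "\<lambda>(u, d, e). (-u - 2 * d, d, e - u - d)"
              and j = "\<lambda>(u, d, e). (-u - 2 * d, d, e - u - d)"])
         (auto simp: A_def liouville_set_def G_def algebra_simps power2_eq_square)
    thus ?thesis by (simp add: sum_negf)
  qed
  finally show ?thesis by (simp only: \<Omega>)
qed


section \<open>Jacobi's theorem on four odd squares\<close>

definition odd_quads :: "int \<Rightarrow> (int \<times> int \<times> int \<times> int) set" where
  "odd_quads N = {(a, b, c, d). odd a \<and> odd b \<and> odd c \<and> odd d \<and> a\<^sup>2 + b\<^sup>2 + c\<^sup>2 + d\<^sup>2 = N}"

lemma finite_odd_quads: "finite (odd_quads N)"
proof (rule finite_subset)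
  have "odd_quads N \<subseteq> {(a, b, c, d). \<bar>a\<bar> \<le> N \<and> \<bar>b\<bar> \<le> N \<and> \<bar>c\<bar> \<le> N \<and> \<bar>d\<bar> \<le> N}"
  proof (clarify, unfold odd_quads_def, clarify, intro conjI)
    fix a b c d :: int
    let ?N = "a\<^sup>2 + b\<^sup>2 + c\<^sup>2 + d\<^sup>2"
    show "\<bar>a\<bar> \<le> ?N" "\<bar>b\<bar> \<le> ?N" "\<bar>c\<bar> \<le> ?N" "\<bar>d\<bar> \<le> ?N"
      by (intro abs_le_of_square_le; simp)+
  qed
  also have "\<dots> \<subseteq> {-N..N} \<times> {-N..N} \<times> {-N..N} \<times> {-N..N}"
    by (clarsimp simp: abs_le_iff)
  finally show "odd_quads N \<subseteq> {-N..N} \<times> {-N..N} \<times> {-N..N} \<times> {-N..N}" .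
qed simp

definition odd_factor_pairs :: "int \<Rightarrow> (int \<times> int) set" where
  "odd_factor_pairs N = {(d, e). odd d \<and> odd e \<and> d > 0 \<and> e > 0 \<and> 4 * d * e = N}"

lemma finite_odd_factor_pairs: "finite (odd_factor_pairs N)"
proof (rule finite_subset)
  show "odd_factor_pairs N \<subseteq> snd ` liouville_set (N + 1)"
  proof
    fix x assume "x \<in> odd_factor_pairs N"
    hence "(1, x) \<in> liouville_set (N + 1)"
      by (auto simp: odd_factor_pairs_def liouville_set_def)
    thus "x \<in> snd ` liouville_set (N + 1)" by force
  qed
  show "finite (snd ` liouville_set (N + 1))"
    using finite_liouville_set by (rule finite_imageI)
qed

lemma finite_odd_square_less: "finite {u :: int. odd u \<and> u\<^sup>2 < M}"
proof (rule finite_subset)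
  show "{u :: int. odd u \<and> u\<^sup>2 < M} \<subseteq> {-M..M}"
  proof
    fix u :: int assume "u \<in> {u. odd u \<and> u\<^sup>2 < M}"
    hence "\<bar>u\<bar> \<le> M" by (intro abs_le_of_square_le) simp
    thus "u \<in> {-M..M}" by (simp add: abs_le_iff)
  qed
qed simp

text \<open>On the solutions of \<open>u\<^sup>2 + a\<^sup>2 + b\<^sup>2 + c\<^sup>2 + d\<^sup>2 = M\<close> the mean of \<open>u\<^sup>2\<close> is \<open>M / 5\<close> by symmetry.\<close>

lemma odd_quads_recurrence:
  "(\<Sum>u | odd u \<and> u\<^sup>2 < M. (M - 5 * u\<^sup>2) * int (card (odd_quads (M - u\<^sup>2)))) = 0"
proof -
  define U where "U = {u :: int. odd u \<and> u\<^sup>2 < M}"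
  have finU: "finite U" unfolding U_def by (rule finite_odd_square_less)
  define V where "V = Sigma U (\<lambda>u. odd_quads (M - u\<^sup>2))"
  have V: "(u, a, b, c, d) \<in> V \<longleftrightarrow>
    odd u \<and> odd a \<and> odd b \<and> odd c \<and> odd d \<and> u\<^sup>2 + a\<^sup>2 + b\<^sup>2 + c\<^sup>2 + d\<^sup>2 = M" for u a b c d
  proof -
    have "u\<^sup>2 < M" if "odd a" "u\<^sup>2 + a\<^sup>2 + b\<^sup>2 + c\<^sup>2 + d\<^sup>2 = M"
    proof -
      have "a\<^sup>2 > 0" using that(1) by auto
      moreover have "b\<^sup>2 \<ge> 0" "c\<^sup>2 \<ge> 0" "d\<^sup>2 \<ge> 0" by simp_all
      ultimately show ?thesis using that(2) by linarith
    qed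
    thus ?thesis by (auto simp: V_def U_def odd_quads_def)
  qed
  define Q where "Q = (\<Sum>(u, a, b, c, d)\<in>V. u\<^sup>2)"
  have "(\<Sum>(u, a, b, c, d)\<in>V. a\<^sup>2) = Q" unfolding Q_def
    by (rule sum.reindex_bij_witness[where i = "\<lambda>(u, a, b, c, d). (a, u, b, c, d)"
          and j = "\<lambda>(u, a, b, c, d). (a, u, b, c, d)"]) (auto simp: V)
  moreover have "(\<Sum>(u, a, b, c, d)\<in>V. b\<^sup>2) = Q" unfolding Q_def
    by (rule sum.reindex_bij_witness[where i = "\<lambda>(u, a, b, c, d). (b, a, u, c, d)"
          and j = "\<lambda>(u, a, b, c, d). (b, a, u, c, d)"]) (auto simp: V)
  moreover have "(\<Sum>(u, a, b, c, d)\<in>V. c\<^sup>2) = Q" unfolding Q_def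
    by (rule sum.reindex_bij_witness[where i = "\<lambda>(u, a, b, c, d). (c, a, b, u, d)"
          and j = "\<lambda>(u, a, b, c, d). (c, a, b, u, d)"]) (auto simp: V)
  moreover have "(\<Sum>(u, a, b, c, d)\<in>V. d\<^sup>2) = Q" unfolding Q_def
    by (rule sum.reindex_bij_witness[where i = "\<lambda>(u, a, b, c, d). (d, a, b, c, u)"
          and j = "\<lambda>(u, a, b, c, d). (d, a, b, c, u)"]) (auto simp: V)
  moreover have "(\<Sum>(u, a, b, c, d)\<in>V. M) = (\<Sum>(u, a, b, c, d)\<in>V. u\<^sup>2 + a\<^sup>2 + b\<^sup>2 + c\<^sup>2 + d\<^sup>2)"
    by (rule sum.cong) (auto simp: V)
  ultimately have "(\<Sum>(u, a, b, c, d)\<in>V. M) = 5 * Q"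
    by (simp add: sum.distrib case_prod_unfold Q_def)
  hence "0 = (\<Sum>(u, a, b, c, d)\<in>V. M - 5 * u\<^sup>2)"
    by (simp add: case_prod_unfold sum_subtractf sum_distrib_left[symmetric] Q_def)
  also have "\<dots> = (\<Sum>u\<in>U. \<Sum>x\<in>odd_quads (M - u\<^sup>2). M - 5 * u\<^sup>2)"
    unfolding V_def using finU finite_odd_quads
    by (subst sum.Sigma) (auto intro!: sum.cong)
  also have "\<dots> = (\<Sum>u\<in>U. (M - 5 * u\<^sup>2) * int (card (odd_quads (M - u\<^sup>2))))"
    by (simp add: mult.commute)
  finally show ?thesis by (simp add: U_def)
qed

text \<open>Since \<open>4 * d * e = M - u\<^sup>2\<close>, the weight
  \<open>M - 5 * u\<^sup>2\<close> equals \<open>4 * (d * e - u\<^sup>2)\<close>, so the total is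
  four times the sum in \<open>liouville_sum\<close>. Divisor sums thus obey the recurrence of
  \<open>odd_quads_recurrence\<close>.\<close>

lemma odd_factor_pairs_recurrence:
  "(\<Sum>u | odd u \<and> u\<^sup>2 < M. (M - 5 * u\<^sup>2) * (\<Sum>(d, e)\<in>odd_factor_pairs (M - u\<^sup>2). d)) = 0"
proof -
  define U where "U = {u :: int. odd u \<and> u\<^sup>2 < M}"
  have finU: "finite U" unfolding U_def by (rule finite_odd_square_less)
  have "(\<Sum>u\<in>U. (M - 5 * u\<^sup>2) * (\<Sum>(d, e)\<in>odd_factor_pairs (M - u\<^sup>2). d)) =
        (\<Sum>u\<in>U. \<Sum>(d, e)\<in>odd_factor_pairs (M - u\<^sup>2). 4 * (d * (d * e - u\<^sup>2)))"
    unfolding sum_distrib_left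
  proof (intro sum.cong refl)
    fix u x assume "x \<in> odd_factor_pairs (M - u\<^sup>2)"
    then obtain d e where x: "x = (d, e)" and "4 * d * e = M - u\<^sup>2"
      by (auto simp: odd_factor_pairs_def)
    hence "M - 5 * u\<^sup>2 = 4 * (d * e - u\<^sup>2)" by simp
    thus "(M - 5 * u\<^sup>2) * (case x of (d, e) \<Rightarrow> d) = (case x of (d, e) \<Rightarrow> 4 * (d * (d * e - u\<^sup>2)))"
      by (simp add: x)
  qed
  also have "\<dots> = (\<Sum>(u, d, e)\<in>Sigma U (\<lambda>u. odd_factor_pairs (M - u\<^sup>2)). 4 * (d * (d * e - u\<^sup>2)))"
    using finU finite_odd_factor_pairs by (subst sum.Sigma) (auto intro!: sum.cong)
  also have "Sigma U (\<lambda>u. odd_factor_pairs (M - u\<^sup>2)) = liouville_set M"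
  proof -
    have "u\<^sup>2 < M" if "d > 0" "e > 0" "u\<^sup>2 + 4 * d * e = M" for u d e :: int
    proof -
      have "0 < d * e" using that by simp
      thus ?thesis using that(3) by linarith
    qed
    hence "(u, d, e) \<in> Sigma U (\<lambda>u. odd_factor_pairs (M - u\<^sup>2)) \<longleftrightarrow> (u, d, e) \<in> liouville_set M" for u d e
      unfolding U_def odd_factor_pairs_def liouville_set_def mem_Sigma_iff mem_Collect_eq case_prod_conv
      by (metis add_diff_cancel_left' diff_add_cancel add.commute)
    thus ?thesis by (simp add: set_eq_iff)
  qed
  also have "(\<Sum>(u, d, e)\<in>liouville_set M. 4 * (d * (d * e - u\<^sup>2))) = 0"
    using liouville_sum[of M] by (simp add: case_prod_unfold sum_distrib_left[symmetric])
  finally show ?thesis by (simp add: U_def)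
qed

lemma sum_odd_factor_pairs:
  assumes "odd m"
  shows "(\<Sum>(d, e)\<in>odd_factor_pairs (4 * int m). d) = int (sigma1 m)"
proof -
  have "(\<Sum>(d, e)\<in>odd_factor_pairs (4 * int m). d) = (\<Sum>d | d dvd m. int d)"
  proof (rule sum.reindex_bij_witness[where i = "\<lambda>d. (int d, int (m div d))" and j = "\<lambda>(d, e). nat d"])
    fix x assume "x \<in> odd_factor_pairs (4 * int m)"
    then obtain d e where x: "x = (d, e)" and *: "d > 0" "e > 0" "d * e = int m"
      by (auto simp: odd_factor_pairs_def)
    have m: "m = nat d * nat e" using * by (metis int_nat_eq nat_int nat_mult_distrib less_imp_le)
    show "(case x of (d, e) \<Rightarrow> nat d) \<in> {d. d dvd m}" by (simp add: x m)
    show "(\<lambda>d. (int d, int (m div d))) (case x of (d, e) \<Rightarrow> nat d) = x"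
      using * by (simp add: x m)
    show "int (case x of (d, e) \<Rightarrow> nat d) = (case x of (d, e) \<Rightarrow> d)" using * by (simp add: x)
  next
    fix d assume "d \<in> {d. d dvd m}"
    then obtain e where m: "m = d * e" by auto
    show "(int d, int (m div d)) \<in> odd_factor_pairs (4 * int m)"
      using assms by (auto simp: m odd_factor_pairs_def intro!: Nat.gr0I)
  qed auto
  thus ?thesis by (simp add: sigma1_def)
qed

text \<open>Both sides satisfy the same recurrence; at \<open>M = 4 * m + 1\<close> it determines
  the value for \<open>m > 1\<close> from smaller odd arguments. Hence the difference
  \<open>D\<close> vanishes by strong induction.\<close>

theorem card_odd_quads:
  assumes "odd m"
  shows "card (odd_quads (4 * int m)) = 16 * sigma1 m"
  using assms
proof (induction m rule: less_induct)
  case (less m)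
  define D where "D = (\<lambda>N. int (card (odd_quads N)) - 16 * (\<Sum>(d, e)\<in>odd_factor_pairs N. d))"
  have D: "D (4 * int k) = 0" if "k < m" "odd k" for k
    using less.IH[OF that] sum_odd_factor_pairs[OF that(2)] by (simp add: D_def)
  show ?case
  proof (cases "m = 1")
    case True
    have ge1: "a\<^sup>2 \<ge> 1" if "odd a" for a :: int
    proof -
      have "0 < a\<^sup>2" using that by auto
      thus ?thesis by linarith
    qed
    have "odd_quads 4 \<subseteq> {-1, 1} \<times> {-1, 1} \<times> {-1, 1} \<times> {-1, 1}"
    proof -
      have "a\<^sup>2 = 1 \<and> b\<^sup>2 = 1 \<and> c\<^sup>2 = 1 \<and> d\<^sup>2 = 1"
        if "odd a" "odd b" "odd c" "odd d" "a\<^sup>2 + b\<^sup>2 + c\<^sup>2 + d\<^sup>2 = 4" for a b c d :: int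
        using ge1[OF that(1)] ge1[OF that(2)] ge1[OF that(3)] ge1[OF that(4)] that(5) by linarith
      thus ?thesis unfolding odd_quads_def power2_eq_1_iff by blast
    qed
    moreover have "{-1, 1} \<times> {-1, 1} \<times> {-1, 1} \<times> {-1, 1} \<subseteq> odd_quads 4"
      by (auto simp: odd_quads_def)
    ultimately have "odd_quads 4 = {-1, 1} \<times> {-1, 1} \<times> {-1, 1} \<times> {-1, 1}"
      by (rule equalityI)
    thus ?thesis by (simp add: True sigma1_def)
  next
    case False
    define M where "M = 4 * int m + 1"
    define U where "U = {u :: int. odd u \<and> u\<^sup>2 < M}"
    have "m > 0" using less.prems by (rule odd_pos)
    hence U1: "{-1, 1} \<subseteq> U" by (auto simp: U_def M_def)
    have finU: "finite U" unfolding U_def by (rule finite_odd_square_less)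
    have "0 = (\<Sum>u\<in>U. (M - 5 * u\<^sup>2) * D (M - u\<^sup>2))"
    proof -
      have "(\<Sum>u\<in>U. (M - 5 * u\<^sup>2) * D (M - u\<^sup>2)) =
        (\<Sum>u\<in>U. (M - 5 * u\<^sup>2) * int (card (odd_quads (M - u\<^sup>2)))) -
        16 * (\<Sum>u\<in>U. (M - 5 * u\<^sup>2) * (\<Sum>(d, e)\<in>odd_factor_pairs (M - u\<^sup>2). d))"
        by (simp add: D_def right_diff_distrib sum_subtractf sum_distrib_left mult_ac)
      thus ?thesis
        using odd_quads_recurrence[of M] odd_factor_pairs_recurrence[of M] by (simp add: U_def)
    qed
    also have "\<dots> = (\<Sum>u\<in>{-1, 1}. (M - 5 * u\<^sup>2) * D (M - u\<^sup>2))"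
    proof (rule sum.mono_neutral_right[OF finU U1], rule ballI)
      fix u assume u: "u \<in> U - {-1, 1}"
      \<comment> \<open>For \<open>u = 2 * k + 1\<close> other than 1 and -1,
        \<open>k * (k + 1)\<close> is even and positive, so \<open>D\<close> is evaluated at four
        times a smaller odd number.\<close>
      then obtain k where k: "u = 2 * k + 1" by (auto simp: U_def elim: oddE)
      have kne: "k \<noteq> 0" "k \<noteq> -1" using u k by auto
      have kk: "k * (k + 1) > 0" using kne by (cases "k > 0") (auto simp: zero_less_mult_iff)
      have eq: "M - u\<^sup>2 = 4 * (int m - k * (k + 1))"
        by (simp add: M_def k power2_eq_square algebra_simps)
      have pos: "int m - k * (k + 1) > 0" using u eq by (simp add: U_def)
      have "odd (int m - k * (k + 1))" using less.prems by auto
      hence "odd (nat (int m - k * (k + 1)))" using pos by (simp add: even_nat_iff)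
      hence "D (4 * int (nat (int m - k * (k + 1)))) = 0"
        using kk pos by (intro D) auto
      hence "D (M - u\<^sup>2) = 0" using eq pos by simp
      thus "(M - 5 * u\<^sup>2) * D (M - u\<^sup>2) = 0" by simp
    qed
    \<comment> \<open>The terms for \<open>u = 1\<close> and \<open>u = -1\<close> coincide, and
      \<open>M - 5 = 4 * (m - 1)\<close> is nonzero because \<open>m \<noteq> 1\<close>.\<close>
    finally have "(M - 5) * D (4 * int m) = 0" by (auto simp: M_def)
    hence "D (4 * int m) = 0" using False by (auto simp: M_def)
    thus ?thesis using sum_odd_factor_pairs[OF less.prems] by (simp add: D_def)
  qed
qed

subsection \<open>The Hurwitz order\<close>

text \<open>\<open>Hur a b c d\<close> is the Hurwitz quaternion \<open>a + b i + c j + d \<omega>\<close> with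
  \<open>\<omega> = (1 + i + j + k) / 2\<close>.\<close>

datatype hurwitz = Hur (h1: int) (hi: int) (hj: int) (hw: int)

instantiation hurwitz :: ring_1
begin

definition "0 = Hur 0 0 0 0"
definition "1 = Hur 1 0 0 0"
definition "x + y = Hur (h1 x + h1 y) (hi x + hi y) (hj x + hj y) (hw x + hw y)"
definition "x - y = Hur (h1 x - h1 y) (hi x - hi y) (hj x - hj y) (hw x - hw y)"
definition "- x = Hur (- h1 x) (- hi x) (- hj x) (- hw x)"
text \<open>Products of basis elements are rewritten with
  \<open>k = 2 * \<omega> - 1 - i - j\<close>; for example
  \<open>i * \<omega> = \<omega> - 1 - j\<close>.\<close>

definition "x * y = (case (x, y) of (Hur a b c d, Hur a' b' c' d') \<Rightarrow> Hur
  (a * a' - b * b' - c * c' - b * c' + c * b' - b * d' - d * c' - d * d')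
  (a * b' + b * a' - b * c' + c * b' + d * b' + c * d' - d * c')
  (a * c' + c * a' - b * c' + c * b' - b * d' + d * b' + c * d')
  (a * d' + d * a' + 2 * b * c' - 2 * c * b' + b * d' - d * b' - c * d' + d * c' + d * d'))"

lemmas hurwitz_defs = zero_hurwitz_def one_hurwitz_def plus_hurwitz_def minus_hurwitz_def
  uminus_hurwitz_def times_hurwitz_def

instance
proof
  fix x y z :: hurwitz
  show "x * y * z = x * (y * z)"
    by (cases x; cases y; cases z; simp add: hurwitz_defs; simp add: algebra_simps)
qed (auto simp: hurwitz_defs algebra_simps split: hurwitz.splits)

end

lemma hur_arith [simp]:
  "Hur a b c d + Hur a' b' c' d' = Hur (a + a') (b + b') (c + c') (d + d')"
  "Hur a b c d - Hur a' b' c' d' = Hur (a - a') (b - b') (c - c') (d - d')"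
  "- Hur a b c d = Hur (- a) (- b) (- c) (- d)"
  by (simp_all add: hurwitz_defs)

lemma of_int_hurwitz: "of_int k = Hur k 0 0 0"
proof (induction k rule: int_induct[where k = 0])
  case base
  show ?case by (simp add: hurwitz_defs)
next
  case (step1 i)
  thus ?case by (simp add: one_hurwitz_def)
next
  case (step2 i)
  thus ?case by (simp add: one_hurwitz_def)
qed

lemma of_int_times_hur [simp]: "of_int k * Hur a b c d = Hur (k * a) (k * b) (k * c) (k * d)"
  and hur_times_of_int [simp]: "Hur a b c d * of_int k = Hur (k * a) (k * b) (k * c) (k * d)"
  by (simp_all add: of_int_hurwitz times_hurwitz_def)

lemma numeral_times_hur [simp]:
  "numeral n * Hur a b c d = Hur (numeral n * a) (numeral n * b) (numeral n * c) (numeral n * d)"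
  using of_int_times_hur[of "numeral n"] by simp

lemma of_int_hurwitz_commute: "of_int k * x = x * (of_int k :: hurwitz)"
  by (cases x) simp

definition hconj :: "hurwitz \<Rightarrow> hurwitz" where
  "hconj x = Hur (h1 x + hw x) (- hi x) (- hj x) (- hw x)"

definition hnorm :: "hurwitz \<Rightarrow> int" where
  "hnorm x = (case x of Hur a b c d \<Rightarrow> a\<^sup>2 + b\<^sup>2 + c\<^sup>2 + d\<^sup>2 + a * d + b * d + c * d)"

lemma hconj_hur [simp]: "hconj (Hur a b c d) = Hur (a + d) (- b) (- c) (- d)"
  by (simp add: hconj_def)

lemma hnorm_hur: "hnorm (Hur a b c d) = a\<^sup>2 + b\<^sup>2 + c\<^sup>2 + d\<^sup>2 + a * d + b * d + c * d"
  by (simp add: hnorm_def)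

text \<open>In the basis \<open>1, i, j, k\<close> the quaternion \<open>2 * x\<close> has the
  coordinates \<open>2 * a + d\<close>, \<open>2 * b + d\<close>, \<open>2 * c + d\<close>,
  \<open>d\<close>. These doubled coordinates are integers of equal parity.\<close>

lemma hnorm_hur4:
  "4 * hnorm (Hur a b c d) = (2 * a + d)\<^sup>2 + (2 * b + d)\<^sup>2 + (2 * c + d)\<^sup>2 + d\<^sup>2"
  by (simp add: hnorm_hur power2_eq_square algebra_simps)

lemma hconj_hconj [simp]: "hconj (hconj x) = x"
  by (cases x) simp

lemma hconj_mult: "hconj (x * y) = hconj y * hconj x"
  by (cases x; cases y) (simp add: times_hurwitz_def algebra_simps)

lemma hnorm_hconj [simp]: "hnorm (hconj x) = hnorm x"
  by (cases x) (simp add: hnorm_hur power2_eq_square algebra_simps)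

lemma hconj_mult_self: "hconj x * x = of_int (hnorm x)"
  and mult_hconj_self: "x * hconj x = of_int (hnorm x)"
  by (cases x; simp add: times_hurwitz_def of_int_hurwitz hnorm_hur power2_eq_square algebra_simps)+

lemma hnorm_mult: "hnorm (x * y) = hnorm x * hnorm y"
proof -
  have "(of_int (hnorm (x * y)) :: hurwitz) = x * (y * hconj y) * hconj x"
    by (simp add: mult_hconj_self[symmetric] hconj_mult mult.assoc)
  also have "\<dots> = of_int (hnorm y) * (x * hconj x)"
    by (simp only: mult_hconj_self[of y] of_int_hurwitz_commute[symmetric] mult.assoc)
  also have "\<dots> = of_int (hnorm x * hnorm y)"
    by (simp only: mult_hconj_self of_int_mult[symmetric] mult.commute)
  finally show ?thesis by (simp add: of_int_hurwitz)
qed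

lemma hnorm_of_int [simp]: "hnorm (of_int k) = k\<^sup>2"
  by (simp add: of_int_hurwitz hnorm_hur)

lemma hnorm_numeral [simp]: "hnorm (numeral n) = (numeral n)\<^sup>2"
  using hnorm_of_int[of "numeral n"] by simp

lemma hnorm_1 [simp]: "hnorm 1 = 1"
  and hnorm_0 [simp]: "hnorm 0 = 0"
  by (simp_all add: hurwitz_defs hnorm_hur)

lemma hnorm_nonneg [simp]: "hnorm x \<ge> 0"
proof (cases x)
  case (Hur a b c d)
  have "0 \<le> (2 * a + d)\<^sup>2 + (2 * b + d)\<^sup>2 + (2 * c + d)\<^sup>2 + d\<^sup>2" by simp
  thus ?thesis using hnorm_hur4[of a b c d] unfolding Hur by linarith
qed

lemma hnorm_eq_0_iff [simp]: "hnorm x = 0 \<longleftrightarrow> x = 0"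
proof (cases x)
  case (Hur a b c d)
  show ?thesis
  proof
    assume "hnorm x = 0"
    hence "(2 * a + d)\<^sup>2 + (2 * b + d)\<^sup>2 + (2 * c + d)\<^sup>2 + d\<^sup>2 = 0"
      using hnorm_hur4[of a b c d] Hur by simp
    thus "x = 0" by (simp add: Hur add_nonneg_eq_0_iff zero_hurwitz_def)
  qed simp
qed

lemma hnorm_pos_iff: "hnorm x > 0 \<longleftrightarrow> x \<noteq> 0"
  by (metis hnorm_nonneg hnorm_eq_0_iff order_less_le)

lemma hnorm_parallelogram: "hnorm (x + y) + hnorm (x - y) = 2 * hnorm x + 2 * hnorm y"
  by (cases x; cases y) (simp add: hnorm_hur power2_eq_square algebra_simps)

lemma nearest_even_multiple:
  fixes X M :: int
  assumes "M > 0"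
  obtains K where "even K" "\<bar>X - M * K\<bar> \<le> M"
proof
  define q where "q = (X + M) div (2 * M)"
  define r where "r = (X + M) mod (2 * M)"
  have "X + M = 2 * M * q + r" by (simp add: q_def r_def)
  moreover have "0 \<le> r" "r < 2 * M" using assms by (simp_all add: r_def)
  moreover have "M * (2 * q) = 2 * M * q" by simp
  ultimately show "\<bar>X - M * (2 * q)\<bar> \<le> M" by linarith
  show "even (2 * q)" by simp
qed

text \<open>Rounding to a Lipschitz quaternion gives \<open>\<le> M\<^sup>2\<close>; equality forces all four
  (doubled) remainders to be \<open>\<plusminus> M\<close>, and then \<open>M\<close> divides \<open>x\<close> in the Hurwitz order.\<close>

lemma hurwitz_division:
  assumes "M > 0"
  shows "\<exists>k. hnorm (x - of_int M * k) < M\<^sup>2"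
proof (cases x)
  case (Hur a b c d)
  obtain K4 where K4: "even K4" "\<bar>d - M * K4\<bar> \<le> M" using nearest_even_multiple assms by blast
  obtain K1 where K1: "even K1" "\<bar>2 * a + d - M * K1\<bar> \<le> M" using nearest_even_multiple assms by blast
  obtain K2 where K2: "even K2" "\<bar>2 * b + d - M * K2\<bar> \<le> M" using nearest_even_multiple assms by blast
  obtain K3 where K3: "even K3" "\<bar>2 * c + d - M * K3\<bar> \<le> M" using nearest_even_multiple assms by blast
  let ?D1 = "2 * a + d - M * K1" and ?D2 = "2 * b + d - M * K2"
    and ?D3 = "2 * c + d - M * K3" and ?D4 = "d - M * K4"
  \<comment> \<open>\<open>k\<close> is the Lipschitz quaternion with doubled coordinates
    \<open>K1\<close>, \<open>K2\<close>, \<open>K3\<close>, \<open>K4\<close>, so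
    \<open>?D1\<close> to \<open>?D4\<close> are the doubled coordinates of the remainder.\<close>
  define k where "k = Hur ((K1 - K4) div 2) ((K2 - K4) div 2) ((K3 - K4) div 2) K4"
  have half: "2 * ((K1 - K4) div 2) = K1 - K4" "2 * ((K2 - K4) div 2) = K2 - K4"
    "2 * ((K3 - K4) div 2) = K3 - K4"
    using K1(1) K2(1) K3(1) K4(1) by simp_all
  have N: "4 * hnorm (x - of_int M * k) = ?D1\<^sup>2 + ?D2\<^sup>2 + ?D3\<^sup>2 + ?D4\<^sup>2"
  proof -
    have *: "2 * (y - M * z) + (d - M * K4) = 2 * y + d - M * (2 * z + K4)" for y z
      by (simp add: algebra_simps)
    show ?thesis
      unfolding Hur k_def of_int_times_hur hur_arith hnorm_hur4 * half by simp
  qed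
  have sq: "t\<^sup>2 \<le> M\<^sup>2" if "\<bar>t\<bar> \<le> M" for t
    using that by (simp add: abs_le_square_iff[symmetric])
  note sqs = sq[OF K1(2)] sq[OF K2(2)] sq[OF K3(2)] sq[OF K4(2)]
  show ?thesis
  proof (cases "hnorm (x - of_int M * k) < M\<^sup>2")
    case True
    thus ?thesis by blast
  next
    case False
    hence eqs: "?D1\<^sup>2 = M\<^sup>2" "?D2\<^sup>2 = M\<^sup>2" "?D3\<^sup>2 = M\<^sup>2" "?D4\<^sup>2 = M\<^sup>2"
      using sqs N by linarith+
    have ex: "\<exists>L. odd L \<and> t = M * L" if "(t - M * K)\<^sup>2 = M\<^sup>2" "even K" for t K
    proof -
      from that(1) consider "t - M * K = M" | "t - M * K = - M"
        by (auto simp: power2_eq_iff)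
      thus ?thesis
      proof cases
        case 1
        hence "t = M * (K + 1)" by (simp add: algebra_simps)
        thus ?thesis using that(2) by (intro exI[of _ "K + 1"]) auto
      next
        case 2
        hence "t = M * (K - 1)" by (simp add: algebra_simps)
        thus ?thesis using that(2) by (intro exI[of _ "K - 1"]) auto
      qed
    qed
    obtain L1 L2 L3 L4 where L: "odd L1" "2 * a + d = M * L1" "odd L2" "2 * b + d = M * L2"
      "odd L3" "2 * c + d = M * L3" "odd L4" "d = M * L4"
      using ex[OF eqs(1) K1(1)] ex[OF eqs(2) K2(1)] ex[OF eqs(3) K3(1)] ex[OF eqs(4) K4(1)] by blast
    have half: "M * ((L - L4) div 2) = y" if "odd L" "2 * y + d = M * L" for L y
    proof -
      have "2 * ((L - L4) div 2) = L - L4" using that(1) L(7) by simp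
      hence "2 * (M * ((L - L4) div 2)) = M * L - M * L4"
        by (metis mult.left_commute right_diff_distrib)
      thus ?thesis using that(2) L(8) by linarith
    qed
    define k' where "k' = Hur ((L1 - L4) div 2) ((L2 - L4) div 2) ((L3 - L4) div 2) L4"
    have "of_int M * k' = x"
      using half[OF L(1,2)] half[OF L(3,4)] half[OF L(5,6)] L(8)
      by (simp add: k'_def Hur)
    hence "hnorm (x - of_int M * k') < M\<^sup>2" using assms by simp
    thus ?thesis by blast
  qed
qed

text \<open>The right ideal generated by \<open>m\<close> and \<open>x\<close> is principal, generated by \<open>g\<close>.\<close>

lemma hurwitz_bezout:
  fixes x :: hurwitz
  assumes "m > 0"
  obtains g s t u v where "g = of_int m * s + x * t" "of_int m = g * u" "x = g * v"
proof -
  define I where "I = {of_int m * s + x * t | s t. True}"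
  have I_diff: "y - z * k \<in> I" if yz: "y \<in> I" "z \<in> I" for y z k
  proof -
    obtain s t where y: "y = of_int m * s + x * t" using yz(1) unfolding I_def by blast
    obtain s' t' where z: "z = of_int m * s' + x * t'" using yz(2) unfolding I_def by blast
    have "y - z * k = of_int m * (s - s' * k) + x * (t - t' * k)"
      by (simp add: y z algebra_simps)
    thus ?thesis unfolding I_def by blast
  qed
  have mI: "of_int m \<in> I" and xI: "x \<in> I"
  proof -
    have "of_int m = of_int m * 1 + x * 0" "x = of_int m * 0 + x * 1" by simp_all
    thus "of_int m \<in> I" "x \<in> I" unfolding I_def by blast+
  qed
  have "(of_int m :: hurwitz) \<noteq> 0" using assms by (simp add: of_int_hurwitz zero_hurwitz_def)
  hence m: "of_int m \<in> I \<and> (of_int m :: hurwitz) \<noteq> 0" using mI by simp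
  define g where "g = arg_min (\<lambda>y. nat (hnorm y)) (\<lambda>y. y \<in> I \<and> y \<noteq> 0)"
  have g: "g \<in> I" "g \<noteq> 0"
    using arg_min_natI[of "\<lambda>y. y \<in> I \<and> y \<noteq> 0", OF m, of "\<lambda>y. nat (hnorm y)"]
    unfolding g_def by simp_all
  have gmin: "hnorm g \<le> hnorm y" if "y \<in> I" "y \<noteq> 0" for y
    using arg_min_nat_le[of "\<lambda>y. y \<in> I \<and> y \<noteq> 0" y "\<lambda>y. nat (hnorm y)"] that
    unfolding g_def[symmetric] by (simp add: nat_le_eq_zle)
  have gen: "\<exists>k. y = g * k" if y: "y \<in> I" for y
  proof -
    \<comment> \<open>Dividing \<open>y\<close> by \<open>g\<close> becomes dividing
      \<open>hconj g * y\<close> by the integer \<open>hnorm g\<close>; afterwards one factor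
      \<open>hnorm g\<close> cancels from the norm inequality.\<close>
    obtain k where k: "hnorm (hconj g * y - of_int (hnorm g) * k) < (hnorm g)\<^sup>2"
      using hurwitz_division g(2) hnorm_pos_iff by blast
    have "hconj g * y - of_int (hnorm g) * k = hconj g * (y - g * k)"
      by (simp add: hconj_mult_self[symmetric] algebra_simps)
    hence "hnorm g * hnorm (y - g * k) < hnorm g * hnorm g"
      using k by (simp add: hnorm_mult power2_eq_square)
    hence "hnorm (y - g * k) < hnorm g"
      using g(2) hnorm_pos_iff[of g] by (simp add: mult_less_cancel_left_pos)
    hence "y - g * k = 0" using gmin[of "y - g * k"] I_diff[OF y g(1)] by force
    thus ?thesis by auto
  qed
  show thesis
    using g(1) gen[OF mI] gen[OF xI] that unfolding I_def by blast
qed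

subsection \<open>Residues modulo 2 and 3\<close>

text \<open>The residue field of the Hurwitz order at the prime above 2 is \<open>F\<^sub>4\<close>; \<open>hcls x\<close> is the
  exponent \<open>e\<close> with \<open>x \<equiv> \<omega>\<^sup>e\<close> there. It is only meaningful for odd norm.\<close>

definition hcls :: "hurwitz \<Rightarrow> nat" where
  "hcls x = (if even (hw x) then 0 else if even (h1 x + hi x + hj x) then 1 else 2)"

lemma odd_hnorm_iff: "odd (hnorm x) \<longleftrightarrow> odd (hw x) \<or> odd (h1 x + hi x + hj x)"
  by (cases x) (auto simp: hnorm_hur)

text \<open>At the prime above 2 both \<open>i\<close> and \<open>j\<close> reduce to 1, so
  \<open>x\<close> reduces to \<open>s + d * \<omega>\<close> in \<open>F\<^sub>4\<close> with
  \<open>s = a + b + c\<close>. Then \<open>hcls\<close> is the discrete logarithm to the base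
  \<omega>, and the two expansions in the proof are the product rule of \<open>F\<^sub>4\<close>,
  where \<open>\<omega>\<^sup>2 = \<omega> + 1\<close>.\<close>

lemma hcls_mult:
  assumes "odd (hnorm x)" "odd (hnorm y)"
  shows "hcls (x * y) = (hcls x + hcls y) mod 3"
proof -
  obtain a b c d where x: "x = Hur a b c d" by (cases x)
  obtain a' b' c' d' where y: "y = Hur a' b' c' d'" by (cases y)
  define s s' where "s = a + b + c" and "s' = a' + b' + c'"
  have "hw (x * y) = s * d' + d * s' + d * d' + 2 * (b * c' - c * b' - d * b' - c * d')"
    by (simp add: x y times_hurwitz_def s_def s'_def algebra_simps)
  moreover have "h1 (x * y) + hi (x * y) + hj (x * y) = s * s' + d * d' +
    2 * (c * b' - b * b' - c * c' - 2 * b * c' - b * d' - d * c' - d * d' + d * b' + c * d')"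
    by (simp add: x y times_hurwitz_def s_def s'_def algebra_simps)
  moreover have "odd d \<or> odd s" "odd d' \<or> odd s'"
    using assms by (simp_all add: odd_hnorm_iff x y s_def s'_def)
  moreover have "hcls x = (if even d then 0 else if even s then 1 else 2)"
    "hcls y = (if even d' then 0 else if even s' then 1 else 2)"
    by (simp_all add: hcls_def x y s_def s'_def)
  ultimately show ?thesis
    unfolding hcls_def[of "x * y"]
    by (cases "even d"; cases "even s"; cases "even d'"; cases "even s'"; simp)
qed

lemma hcls_1 [simp]: "hcls 1 = 0"
  by (simp add: hcls_def one_hurwitz_def)

lemma hcls_less: "hcls x < 3"
  by (simp add: hcls_def)

definition hcong :: "hurwitz \<Rightarrow> hurwitz \<Rightarrow> bool" where
  "hcong x y \<longleftrightarrow> (\<exists>z. x - y = of_int 3 * z)"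

lemma hcong_hur: "hcong (Hur a b c d) (Hur a' b' c' d') \<longleftrightarrow>
  3 dvd a - a' \<and> 3 dvd b - b' \<and> 3 dvd c - c' \<and> 3 dvd d - d'"
proof
  assume "hcong (Hur a b c d) (Hur a' b' c' d')"
  then obtain z where "Hur a b c d - Hur a' b' c' d' = of_int 3 * z" by (auto simp: hcong_def)
  thus "3 dvd a - a' \<and> 3 dvd b - b' \<and> 3 dvd c - c' \<and> 3 dvd d - d'"
    by (cases z) simp
next
  assume "3 dvd a - a' \<and> 3 dvd b - b' \<and> 3 dvd c - c' \<and> 3 dvd d - d'"
  then obtain p q r s where "a - a' = 3 * p" "b - b' = 3 * q" "c - c' = 3 * r" "d - d' = 3 * s"
    by (auto elim!: dvdE)
  thus "hcong (Hur a b c d) (Hur a' b' c' d')"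
    unfolding hcong_def by (intro exI[of _ "Hur p q r s"]) simp
qed

lemma hcong_refl [simp]: "hcong x x"
  by (cases x) (simp add: hcong_hur)

lemma hcong_sym:
  assumes "hcong x y"
  shows "hcong y x"
proof -
  obtain z where "x - y = of_int 3 * z" using assms unfolding hcong_def by blast
  hence "y - x = of_int 3 * (- z)" by (metis minus_diff_eq mult_minus_right)
  thus ?thesis unfolding hcong_def by blast
qed

lemma hcong_trans [trans]:
  assumes "hcong x y" "hcong y z"
  shows "hcong x z"
proof -
  obtain v w where "x - y = of_int 3 * v" "y - z = of_int 3 * w"
    using assms unfolding hcong_def by blast
  hence "x - z = of_int 3 * (v + w)" by (simp only: distrib_left) (metis add_diff_eq diff_add_cancel)
  thus ?thesis unfolding hcong_def by blast
qed

lemma hcong_mult_right: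
  assumes "hcong x y"
  shows "hcong (x * z) (y * z)"
proof -
  obtain w where "x - y = of_int 3 * w" using assms unfolding hcong_def by blast
  hence "x * z - y * z = of_int 3 * (w * z)" by (simp only: mult.assoc flip: left_diff_distrib)
  thus ?thesis unfolding hcong_def by blast
qed

lemma hcong_1_mult: "hcong x 1 \<Longrightarrow> hcong (x * y) y"
  using hcong_mult_right[of x 1 y] by simp

lemma finite_hnorm: "finite {x. hnorm x = n}"
proof (rule finite_subset)
  let ?I = "{- 4 * n..4 * n}"
  show "{x. hnorm x = n} \<subseteq> (\<lambda>(p, q, r, d). Hur ((p - d) div 2) ((q - d) div 2) ((r - d) div 2) d) `
    (?I \<times> ?I \<times> ?I \<times> ?I)"
  proof
    fix x assume "x \<in> {x. hnorm x = n}"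
    moreover obtain a b c d where x: "x = Hur a b c d" by (cases x)
    ultimately have n: "4 * n = (2 * a + d)\<^sup>2 + (2 * b + d)\<^sup>2 + (2 * c + d)\<^sup>2 + d\<^sup>2"
      using hnorm_hur4[of a b c d] by simp
    have "\<bar>2 * a + d\<bar> \<le> 4 * n" "\<bar>2 * b + d\<bar> \<le> 4 * n" "\<bar>2 * c + d\<bar> \<le> 4 * n" "\<bar>d\<bar> \<le> 4 * n"
      unfolding n by (intro abs_le_of_square_le; simp)+
    thus "x \<in> (\<lambda>(p, q, r, d). Hur ((p - d) div 2) ((q - d) div 2) ((r - d) div 2) d) `
      (?I \<times> ?I \<times> ?I \<times> ?I)"
      by (intro image_eqI[of _ _ "(2 * a + d, 2 * b + d, 2 * c + d, d)"]) (simp_all add: x abs_le_iff)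
  qed
qed simp

subsection \<open>Units\<close>

text \<open>The first eight units are \<open>1, i, j, k\<close> up to sign, with \<open>k\<close>
  written as \<open>-1 - i - j + 2 * \<omega>\<close>. The other sixteen are half the sums of
  \<open>1, i, j, k\<close> with arbitrary signs.\<close>

definition hunits_list :: "(int \<times> int \<times> int \<times> int) list" where
  "hunits_list =
  [(1,0,0,0), (-1,0,0,0), (0,1,0,0), (0,-1,0,0), (0,0,1,0), (0,0,-1,0),
   (-1,-1,-1,2), (1,1,1,-2),
   (0,0,0,1), (-1,0,0,1), (0,-1,0,1), (0,0,-1,1), (-1,-1,0,1), (-1,0,-1,1), (0,-1,-1,1), (-1,-1,-1,1),
   (0,0,0,-1), (1,0,0,-1), (0,1,0,-1), (0,0,1,-1), (1,1,0,-1), (1,0,1,-1), (0,1,1,-1), (1,1,1,-1)]"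

text \<open>Modulo 3 the Hurwitz order is the ring of 2 by 2 matrices over the field with three
  elements and the norm is the determinant; the 24 units map onto the group \<open>SL_2\<close>. The
  proof checks all 81 residues.\<close>

lemma unit_residue:
  assumes "hnorm x mod 3 = 1"
  obtains u where "hnorm u = 1" "hcong u x"
proof -
  obtain a b c d where x: "x = Hur a b c d" by (cases x)
  have chk: "\<forall>a\<in>set [0,1,2::int]. \<forall>b\<in>set [0,1,2::int]. \<forall>c\<in>set [0,1,2::int]. \<forall>d\<in>set [0,1,2::int].
    (a * a + b * b + c * c + d * d + a * d + b * d + c * d) mod 3 = 1 \<longrightarrow>
    (\<exists>(p, q, r, s)\<in>set hunits_list. (p - a) mod 3 = 0 \<and> (q - b) mod 3 = 0 \<and> (r - c) mod 3 = 0 \<and>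
       (s - d) mod 3 = 0 \<and> p * p + q * q + r * r + s * s + p * s + q * s + r * s = 1)"
    by code_simp
  have in3: "t mod 3 \<in> set [0, 1, 2]" for t :: int
  proof -
    have "0 \<le> t mod 3" "t mod 3 < 3" by simp_all
    thus ?thesis by simp linarith
  qed
  have "(a mod 3 * (a mod 3) + b mod 3 * (b mod 3) + c mod 3 * (c mod 3) +
    d mod 3 * (d mod 3) + a mod 3 * (d mod 3) + b mod 3 * (d mod 3) + c mod 3 * (d mod 3)) mod 3 =
    hnorm x mod 3"
    unfolding x hnorm_hur power2_eq_square cong_def[symmetric]
    by (intro cong_add cong_mult) (simp_all add: cong_def)
  also note assms
  finally have H: "(a mod 3 * (a mod 3) + b mod 3 * (b mod 3) + c mod 3 * (c mod 3) +
    d mod 3 * (d mod 3) + a mod 3 * (d mod 3) + b mod 3 * (d mod 3) + c mod 3 * (d mod 3)) mod 3 = 1" .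
  from chk[rule_format, OF in3[of a] in3[of b] in3[of c] in3[of d] H]
  obtain z where "z \<in> set hunits_list"
    and "case z of (p, q, r, s) \<Rightarrow> (p - a mod 3) mod 3 = 0 \<and> (q - b mod 3) mod 3 = 0 \<and>
      (r - c mod 3) mod 3 = 0 \<and> (s - d mod 3) mod 3 = 0 \<and>
      p * p + q * q + r * r + s * s + p * s + q * s + r * s = 1"
    by (rule bexE)
  moreover obtain p q r s where "z = (p, q, r, s)" by (rule prod_cases4)
  ultimately have *: "(p - a mod 3) mod 3 = 0" "(q - b mod 3) mod 3 = 0" "(r - c mod 3) mod 3 = 0"
    "(s - d mod 3) mod 3 = 0" "p * p + q * q + r * r + s * s + p * s + q * s + r * s = 1"
    by (simp_all only: prod.case)
  have dv: "3 dvd p - a" if "(p - a mod 3) mod 3 = 0" for p a :: int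
    using that by presburger
  have "hnorm (Hur p q r s) = 1"
    unfolding hnorm_hur power2_eq_square by (rule *(5))
  moreover have "hcong (Hur p q r s) x"
    unfolding x hcong_hur by (intro conjI dv *(1-4))
  ultimately show thesis by (rule that)
qed

text \<open>The norm of \<open>u - v\<close> is a multiple of 9, yet the parallelogram law bounds it
  by 4.\<close>

lemma unit_cong_imp_eq:
  assumes "hnorm u = 1" "hnorm v = 1" "hcong u v"
  shows "u = v"
proof -
  obtain z where z: "u - v = of_int 3 * z" using assms(3) by (auto simp: hcong_def)
  have "hnorm (u - v) = 9 * hnorm z" by (simp add: z hnorm_mult)
  moreover have "hnorm (u - v) \<le> 4"
    using hnorm_parallelogram[of u v] hnorm_nonneg[of "u + v"] assms by linarith
  ultimately have "hnorm z = 0" using hnorm_nonneg[of z] by linarith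
  thus ?thesis using z by simp
qed

lemma unit_mult_hconj: "hnorm u = 1 \<Longrightarrow> u * hconj u = 1" "hnorm u = 1 \<Longrightarrow> hconj u * u = 1"
  by (simp_all add: mult_hconj_self hconj_mult_self)

lemma units_eq: "{u. hnorm u = 1} = (\<lambda>(a, b, c, d). Hur a b c d) ` set hunits_list"
proof (intro equalityI subsetI)
  fix u assume "u \<in> {u. hnorm u = 1}"
  moreover obtain a b c d where u: "u = Hur a b c d" by (cases u)
  ultimately have N: "a * a + b * b + c * c + d * d + a * d + b * d + c * d = 1"
    by (simp add: hnorm_hur power2_eq_square)
  \<comment> \<open>The norm equation forces \<open>|d| \<le> 2\<close> and
    \<open>|2 * a + d| \<le> 2\<close>, hence \<open>|a| \<le> 2\<close>, and likewise for
    \<open>b\<close> and \<open>c\<close>.\<close>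
  have chk: "\<forall>a\<in>set [-2..2]. \<forall>b\<in>set [-2..2]. \<forall>c\<in>set [-2..2]. \<forall>d\<in>set [-2..2].
    a * a + b * b + c * c + d * d + a * d + b * d + c * d = 1 \<longrightarrow> (a, b, c, d) \<in> set hunits_list"
    by code_simp
  have "(2 * a + d)\<^sup>2 + (2 * b + d)\<^sup>2 + (2 * c + d)\<^sup>2 + d\<^sup>2 = 4"
    using N by (simp add: power2_eq_square algebra_simps)
  moreover have "0 \<le> (2 * a + d)\<^sup>2" "0 \<le> (2 * b + d)\<^sup>2" "0 \<le> (2 * c + d)\<^sup>2" "0 \<le> d\<^sup>2" by simp_all
  ultimately have "(2 * a + d)\<^sup>2 \<le> 2\<^sup>2" "(2 * b + d)\<^sup>2 \<le> 2\<^sup>2" "(2 * c + d)\<^sup>2 \<le> 2\<^sup>2" "d\<^sup>2 \<le> 2\<^sup>2"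
    unfolding power2_eq_square by linarith+
  hence "\<bar>2 * a + d\<bar> \<le> 2" "\<bar>2 * b + d\<bar> \<le> 2" "\<bar>2 * c + d\<bar> \<le> 2" "\<bar>d\<bar> \<le> 2"
    by (simp_all only: abs_le_square_iff[symmetric] abs_numeral)
  hence "a \<in> set [-2..2]" "b \<in> set [-2..2]" "c \<in> set [-2..2]" "d \<in> set [-2..2]"
    unfolding set_upto atLeastAtMost_iff by linarith+
  hence "(a, b, c, d) \<in> set hunits_list" using chk N by blast
  thus "u \<in> (\<lambda>(a, b, c, d). Hur a b c d) ` set hunits_list" by (force simp: u)
next
  fix u assume "u \<in> (\<lambda>(a, b, c, d). Hur a b c d) ` set hunits_list"
  thus "u \<in> {u. hnorm u = 1}" by (auto simp: hunits_list_def hnorm_hur)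
qed

text \<open>Each class contains eight of the 24 units, and the condition excludes one class.\<close>

lemma card_units_hcls:
  assumes "i < 3"
  shows "card {u. hnorm u = 1 \<and> (i + hcls u) mod 3 \<noteq> 0} = 16"
proof -
  have "{u. hnorm u = 1 \<and> (i + hcls u) mod 3 \<noteq> 0} =
    {u \<in> (\<lambda>(a, b, c, d). Hur a b c d) ` set hunits_list. (i + hcls u) mod 3 \<noteq> 0}"
    using units_eq by blast
  also have "\<dots> = set (filter (\<lambda>u. (i + hcls u) mod 3 \<noteq> 0) (map (\<lambda>(a, b, c, d). Hur a b c d) hunits_list))"
    by auto
  also have "card \<dots> = length (filter (\<lambda>u. (i + hcls u) mod 3 \<noteq> 0) (map (\<lambda>(a, b, c, d). Hur a b c d) hunits_list))"
    by (intro distinct_card distinct_filter) (simp add: hunits_list_def)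
  also have "\<dots> = 16"
  proof -
    consider "i = 0" | "i = 1" | "i = 2" using assms by linarith
    thus ?thesis by cases (simp_all add: hunits_list_def hcls_def)
  qed
  finally show ?thesis .
qed

subsection \<open>Counting quaternions by residue and factorization\<close>

text \<open>\<open>hset n j 1\<close> is the set counted by \<open>c\<^sub>j(n)\<close>; other
  residues \<open>r\<close> occur only until multiplication by a unit moves them to 1.\<close>

definition hset :: "int \<Rightarrow> nat \<Rightarrow> hurwitz \<Rightarrow> hurwitz set" where
  "hset n i r = {x. hnorm x = n \<and> hcls x = i \<and> hcong x r}"

lemma finite_hset [simp]: "finite (hset n i r)"
  by (rule finite_subset[OF _ finite_hnorm[of n]]) (auto simp: hset_def)

lemma hset_cong: "hcong r r' \<Longrightarrow> hset n i r = hset n i r'"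
  unfolding hset_def using hcong_trans hcong_sym by blast

lemma mod3_cancel:
  fixes a b c :: nat
  assumes "(a + c) mod 3 = (b + c) mod 3" "a < 3" "b < 3"
  shows "a = b"
  using assms by presburger

lemma mod3_diff:
  fixes a b j :: nat
  assumes "a < 3" "b < 3" "j < 3"
  shows "b = (j + 3 - a) mod 3 \<longleftrightarrow> (a + b) mod 3 = j"
proof -
  have "a = 0 \<or> a = 1 \<or> a = 2" "b = 0 \<or> b = 1 \<or> b = 2" "j = 0 \<or> j = 1 \<or> j = 2"
    using assms by linarith+
  thus ?thesis by (elim disjE) simp_all
qed

text \<open>Right multiplication by a unit is undone by its conjugate. It moves the residue modulo 3
  at the price of a shift of the class.\<close>

lemma card_hset_mult_unit:
  assumes u: "hnorm u = 1" and n: "odd n" and i: "i < 3"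
  shows "card (hset n i r) = card (hset n ((i + hcls u) mod 3) (r * u))"
proof (rule bij_betw_same_card[OF bij_betw_byWitness[where f = "\<lambda>x. x * u" and f' = "\<lambda>x. x * hconj u"]])
  show "(\<lambda>x. x * u) ` hset n i r \<subseteq> hset n ((i + hcls u) mod 3) (r * u)"
    using u n by (auto simp: hset_def hnorm_mult hcls_mult hcong_mult_right)
  show "(\<lambda>x. x * hconj u) ` hset n ((i + hcls u) mod 3) (r * u) \<subseteq> hset n i r"
  proof clarify
    fix x assume x: "x \<in> hset n ((i + hcls u) mod 3) (r * u)"
    define y where "y = x * hconj u"
    have yu: "y * u = x" using unit_mult_hconj[OF u] by (simp add: y_def mult.assoc)
    have y: "hnorm y = n" using x u by (simp add: y_def hnorm_mult hset_def)
    have "(hcls y + hcls u) mod 3 = (i + hcls u) mod 3"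
      using hcls_mult[of y u] x y n u by (simp add: yu hset_def)
    hence "hcls y = i" by (rule mod3_cancel[OF _ hcls_less i])
    moreover have "hcong y r"
      using hcong_mult_right[of x "r * u" "hconj u"] x unit_mult_hconj[OF u]
      by (simp add: y_def hset_def mult.assoc)
    ultimately show "x * hconj u \<in> hset n i r" using y by (simp add: hset_def y_def)
  qed
qed (use unit_mult_hconj[OF u] in \<open>simp_all add: mult.assoc\<close>)

text \<open>Conjugation maps \<omega> to \<open>1 - \<omega>\<close>, which is
  \<open>\<omega>\<^sup>2\<close> in \<open>F\<^sub>4\<close>, so it exchanges the classes 1 and 2;
  it preserves the residue 1 modulo 3.\<close>

lemma card_hset_conj:
  assumes "odd n"
  shows "card (hset n 1 1) = card (hset n 2 1)"
proof (rule bij_betw_same_card[OF bij_betw_byWitness[where f = hconj and f' = hconj]])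
  have cls: "hcls (hconj x) = 2" if "hcls x = 1" for x
    using that by (cases x) (auto simp: hcls_def split: if_splits)
  have cls': "hcls (hconj x) = 1" if "hcls x = 2" for x
    using that by (cases x) (auto simp: hcls_def split: if_splits)
  have cong: "hcong (hconj x) 1" if "hcong x 1" for x
  proof (cases x)
    case (Hur a b c d)
    hence *: "3 dvd a - 1" "3 dvd b" "3 dvd c" "3 dvd d"
      using that by (simp_all add: one_hurwitz_def hcong_hur)
    hence "3 dvd a + d - 1" by presburger
    with * show ?thesis by (simp add: Hur one_hurwitz_def hcong_hur)
  qed
  show "hconj ` hset n 1 1 \<subseteq> hset n 2 1" "hconj ` hset n 2 1 \<subseteq> hset n 1 1"
    using cls cls' cong by (auto simp: hset_def)
qed simp_all

text \<open>Every quaternion of this norm is uniquely \<open>x * u\<close> with \<open>x\<close>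
  congruent to 1 modulo 3 and \<open>u\<close> a unit: the residue of the product determines
  \<open>u\<close>. For each \<open>x\<close> exactly 16 units keep the class of the product away
  from 0.\<close>

lemma card_nonzero_hcls:
  assumes n: "odd n" "n mod 3 = 1"
  shows "card {x. hnorm x = n \<and> hcls x \<noteq> 0} =
    16 * (card (hset n 0 1) + card (hset n 1 1) + card (hset n 2 1))"
proof -
  define W where "W = (\<lambda>i. {u. hnorm u = 1 \<and> (i + hcls u) mod 3 \<noteq> 0})"
  define S where "S = (\<Union>i<3. hset n i 1 \<times> W i)"
  have fin: "finite (W i)" for i
    by (rule finite_subset[OF _ finite_hnorm[of 1]]) (auto simp: W_def)
  have S: "(x, u) \<in> S \<longleftrightarrow> hnorm x = n \<and> hcong x 1 \<and> hnorm u = 1 \<and> (hcls x + hcls u) mod 3 \<noteq> 0" for x u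
    using hcls_less[of x] by (auto simp: S_def W_def hset_def)
  have "bij_betw (\<lambda>(x, u). x * u) S {x. hnorm x = n \<and> hcls x \<noteq> 0}"
    unfolding bij_betw_def
  proof (intro conjI equalityI subsetI inj_onI)
    fix p q assume pq: "p \<in> S" "q \<in> S" "(\<lambda>(x, u). x * u) p = (\<lambda>(x, u). x * u) q"
    obtain x u y v where p: "p = (x, u)" and q: "q = (y, v)" by (cases p; cases q)
    have *: "hcong x 1" "hnorm u = 1" "hcong y 1" "hnorm v = 1" "x * u = y * v"
      using pq by (simp_all add: p q S)
    have "hcong u (x * u)" using hcong_1_mult[OF *(1)] by (rule hcong_sym)
    also have "hcong (x * u) v" unfolding *(5) using *(3) by (rule hcong_1_mult)
    finally have "u = v" by (rule unit_cong_imp_eq[OF *(2,4)])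
    moreover have "x * u * hconj u = x" "y * v * hconj v = y"
      by (simp_all only: mult.assoc unit_mult_hconj(1)[OF *(2)] unit_mult_hconj(1)[OF *(4)] mult_1_right)
    ultimately have "x = y" using *(5) by metis
    with \<open>u = v\<close> show "p = q" by (simp add: p q)
  next
    fix z assume "z \<in> (\<lambda>(x, u). x * u) ` S"
    thus "z \<in> {x. hnorm x = n \<and> hcls x \<noteq> 0}"
      using n by (auto simp: S hnorm_mult hcls_mult)
  next
    fix z assume z: "z \<in> {x. hnorm x = n \<and> hcls x \<noteq> 0}"
    obtain u where u: "hnorm u = 1" "hcong u z" using unit_residue[of z] n z by auto
    define x where "x = z * hconj u"
    have xu: "x * u = z" using unit_mult_hconj[OF u(1)] by (simp add: x_def mult.assoc)
    have N: "hnorm x = n" using z u by (simp add: x_def hnorm_mult)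
    have "hcong x 1"
      using hcong_mult_right[OF hcong_sym[OF u(2)], of "hconj u"] unit_mult_hconj[OF u(1)]
      by (simp add: x_def)
    moreover have "(hcls x + hcls u) mod 3 = hcls z"
      using hcls_mult[of x u] n N u by (simp add: xu)
    ultimately have "(x, u) \<in> S" using N u z by (simp add: S)
    thus "z \<in> (\<lambda>(x, u). x * u) ` S" using xu by force
  qed
  hence "card {x. hnorm x = n \<and> hcls x \<noteq> 0} = card S" by (rule bij_betw_same_card[symmetric])
  also have "card S = (\<Sum>i<3. card (hset n i 1 \<times> W i))"
    unfolding S_def by (rule card_UN_disjoint, simp, simp add: fin, auto simp: hset_def)
  also have "\<dots> = (\<Sum>i<3. card (hset n i 1) * 16)"
    by (rule sum.cong) (simp_all only: card_cartesian_product W_def card_units_hcls lessThan_iff)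
  finally show ?thesis by (simp add: numeral_3_eq_3 eval_nat_numeral)
qed

text \<open>A generator of the right ideal spanned by \<open>m\<close> and \<open>z\<close> serves
  as left factor. Coprimality makes its norm equal to \<open>m\<close>, and a unit moved between the
  factors makes both congruent to 1.\<close>

lemma hset_factor:
  assumes m: "m > 0" "m mod 3 = 1" and n: "n > 0" and cop: "coprime m n"
    and z: "hnorm z = m * n" "hcong z 1"
  obtains x y where "z = x * y" "hnorm x = m" "hnorm y = n" "hcong x 1" "hcong y 1"
proof -
  obtain g s t u v where g: "g = of_int m * s + z * t" "of_int m = g * u" "z = g * v"
    using hurwitz_bezout[OF m(1)] by metis
  have "m * m = hnorm g * hnorm u" "m * n = hnorm g * hnorm v"
    using g(2) z(1) hnorm_of_int[of m] by (metis hnorm_mult power2_eq_square, metis g(3) hnorm_mult)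
  hence "hnorm g dvd gcd (m * m) (m * n)" by (metis dvd_triv_left gcd_greatest)
  moreover have "gcd (m * m) (m * n) = m"
    using cop m(1) by (simp add: gcd_mult_left)
  ultimately have "hnorm g dvd m" by simp
  \<comment> \<open>When \<open>g * hconj g\<close> is expanded, every term shows a factor
    \<open>m\<close> except \<open>z * t * hconj t * hconj z\<close>, whose value is
    \<open>hnorm t * (m * n)\<close>.\<close>
  moreover have "m dvd hnorm g"
  proof -
    have "(of_int (hnorm g) :: hurwitz) = g * hconj g" by (simp add: mult_hconj_self)
    also have "hconj g = hconj s * of_int m + hconj t * hconj z"
    proof -
      have add: "hconj (x + y) = hconj x + hconj y" for x y
        by (cases x; cases y) simp
      have int: "hconj (of_int k) = of_int k" for k
        by (simp add: of_int_hurwitz)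
      show ?thesis unfolding g(1) add hconj_mult int ..
    qed
    also have "g * \<dots> = g * hconj s * of_int m + (of_int m * s + z * t) * (hconj t * hconj z)"
      using g(1) by (simp add: distrib_left mult.assoc)
    also have "\<dots> = of_int m * (g * hconj s + s * hconj t * hconj z) + z * (t * hconj t) * hconj z"
      by (simp add: distrib_left distrib_right mult.assoc of_int_hurwitz_commute[of m "g * hconj s", unfolded mult.assoc])
    also have "z * (t * hconj t) * hconj z = of_int m * (of_int n * of_int (hnorm t))"
    proof -
      have "z * (t * hconj t) * hconj z = of_int (hnorm t) * (z * hconj z)"
        by (simp only: mult_hconj_self[of t] of_int_hurwitz_commute[symmetric] mult.assoc)
      also have "\<dots> = of_int (hnorm t * (m * n))"
        by (simp only: mult_hconj_self z(1) of_int_mult)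
      also have "\<dots> = of_int (m * (n * hnorm t))" by (simp only: mult_ac)
      finally show ?thesis by simp
    qed
    finally have "of_int (hnorm g) = of_int m * (g * hconj s + s * hconj t * hconj z + of_int n * of_int (hnorm t))"
      by (simp add: distrib_left)
    then obtain w where w: "of_int (hnorm g) = of_int m * (w :: hurwitz)" by blast
    have "hnorm g = m * h1 w" using w by (cases w) (simp add: of_int_hurwitz[of "hnorm g"])
    thus ?thesis by simp
  qed
  ultimately have N: "hnorm g = m" using m(1) by (intro zdvd_antisym_nonneg) auto
  \<comment> \<open>The norm of \<open>g\<close> is 1 modulo 3, so some unit \<open>e\<close> shares
    its residue. Then \<open>g * hconj e\<close> is congruent to 1, and \<open>e * v\<close> is too
    because the product is.\<close>
  obtain e where e: "hnorm e = 1" "hcong e g" using unit_residue[of g] N m by auto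
  define x where "x = g * hconj e"
  define y where "y = e * v"
  have xy: "z = x * y" using unit_mult_hconj[OF e(1)]
    by (simp add: x_def y_def g(3) mult.assoc flip: mult.assoc[of "hconj e" e])
  have x: "hnorm x = m" using N e by (simp add: x_def hnorm_mult)
  have "m * hnorm y = m * n" using z(1) x xy by (simp add: hnorm_mult)
  hence y: "hnorm y = n" using m(1) by simp
  have cx: "hcong x 1"
    using hcong_mult_right[OF hcong_sym[OF e(2)], of "hconj e"] unit_mult_hconj[OF e(1)] by (simp add: x_def)
  have "hcong y z" unfolding xy using hcong_1_mult[OF cx] by (rule hcong_sym)
  hence "hcong y 1" using z(2) hcong_trans by blast
  with xy x y cx show thesis by (rule that)
qed

text \<open>Writing 1 as \<open>a * m + b * n\<close> puts \<open>x\<close> into the right ideal of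
  \<open>x'\<close>: \<open>x * m\<close> lies there since \<open>m = x' * hconj x'\<close>, and
  \<open>x * n\<close> since \<open>n = y * hconj y\<close> and \<open>x * y = x' * y'\<close>. The
  quotient is a unit congruent to 1, hence 1.\<close>

lemma hset_factor_unique:
  assumes m: "m > 0" and cop: "coprime m n"
    and x: "hnorm x = m" "hcong x 1" "hnorm x' = m" "hcong x' 1"
    and y: "hnorm y = n" and eq: "x * y = x' * y'"
  shows "x = x' \<and> y = y'"
proof -
  obtain a b where ab: "a * m + b * n = 1"
    using cop bezout_int[of m n] by (metis coprime_imp_gcd_eq_1)
  have "x = x * of_int (m * a + n * b)" using ab by (simp add: mult.commute)
  also have "\<dots> = x * of_int m * of_int a + x * of_int n * of_int b"
    by (simp only: of_int_add of_int_mult distrib_left mult.assoc)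
  also have "x * of_int m = x' * (hconj x' * x)"
    using mult_hconj_self[of x'] x by (simp only: of_int_hurwitz_commute[symmetric] mult.assoc[symmetric])
  also have "x * of_int n = x' * (y' * hconj y)"
    using mult_hconj_self[of y] y eq by (simp only: mult.assoc[symmetric]) (metis mult.assoc)
  finally have "x = x' * (hconj x' * x * of_int a + y' * hconj y * of_int b)"
    by (simp only: distrib_left mult.assoc)
  then obtain e where e: "x = x' * e" by blast
  have "m * hnorm e = m * 1" using e x by (metis hnorm_mult mult.right_neutral)
  hence "hnorm e = 1" using m by simp
  moreover have "hcong e 1"
  proof -
    have "hcong e x" unfolding e using hcong_1_mult[OF x(4)] by (rule hcong_sym)
    thus ?thesis using x(2) hcong_trans by blast
  qed
  ultimately have "e = 1" by (intro unit_cong_imp_eq) auto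
  hence xx: "x = x'" using e by simp
  have "x * (y - y') = 0" using eq xx by (simp add: right_diff_distrib)
  hence "hnorm x * hnorm (y - y') = 0" by (simp flip: hnorm_mult)
  hence "y = y'" using m x by simp
  with xx show ?thesis by simp
qed

text \<open>Factorization is a bijection and classes add, so the counts convolve over
  \<open>Z/3\<close>. The summand 3 in \<open>j + 3 - i\<close> keeps the subtraction from
  truncating.\<close>

lemma card_hset_mult:
  assumes m: "m > 0" "m mod 3 = 1" "odd m" and n: "n > 0" "odd n" and cop: "coprime m n" and j: "j < 3"
  shows "card (hset (m * n) j 1) = (\<Sum>i<3. card (hset m i 1) * card (hset n ((j + 3 - i) mod 3) 1))"
proof -
  define S where "S = (\<Union>i<3. hset m i 1 \<times> hset n ((j + 3 - i) mod 3) 1)"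
  have S: "(x, y) \<in> S \<longleftrightarrow> hnorm x = m \<and> hnorm y = n \<and> hcong x 1 \<and> hcong y 1 \<and> (hcls x + hcls y) mod 3 = j" for x y
  proof -
    have "hcls y = (j + 3 - hcls x) mod 3 \<longleftrightarrow> (hcls x + hcls y) mod 3 = j"
      by (rule mod3_diff) (fact hcls_less j)+
    thus ?thesis using hcls_less[of x] by (auto simp: S_def hset_def)
  qed
  have "bij_betw (\<lambda>(x, y). x * y) S (hset (m * n) j 1)"
    unfolding bij_betw_def
  proof (intro conjI equalityI subsetI inj_onI)
    fix p q assume pq: "p \<in> S" "q \<in> S" "(\<lambda>(x, u). x * u) p = (\<lambda>(x, u). x * u) q"
    thus "p = q" using hset_factor_unique[OF m(1) cop]
      by (cases p; cases q) (auto simp: S)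
  next
    fix z assume "z \<in> (\<lambda>(x, y). x * y) ` S"
    then obtain x y where z: "z = x * y" and xy: "(x, y) \<in> S" by auto
    have "hcong (x * y) y" using xy by (intro hcong_1_mult) (simp add: S)
    hence "hcong z 1" unfolding z using xy hcong_trans by (auto simp: S)
    thus "z \<in> hset (m * n) j 1"
      using xy m n by (simp add: S z hset_def hnorm_mult hcls_mult)
  next
    fix z assume z: "z \<in> hset (m * n) j 1"
    then obtain x y where xy: "z = x * y" "hnorm x = m" "hnorm y = n" "hcong x 1" "hcong y 1"
      using hset_factor[OF m(1,2) n(1) cop, of z] by (auto simp: hset_def)
    have "(x, y) \<in> S" using xy z m n by (simp add: S hset_def hcls_mult)
    thus "z \<in> (\<lambda>(x, y). x * y) ` S" using xy(1) by force
  qed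
  hence "card (hset (m * n) j 1) = card S" by (rule bij_betw_same_card[symmetric])
  also have "card S = (\<Sum>i<3. card (hset m i 1 \<times> hset n ((j + 3 - i) mod 3) 1))"
    unfolding S_def by (rule card_UN_disjoint, simp, simp, auto simp: hset_def)
  finally show ?thesis by (simp add: card_cartesian_product)
qed

subsection \<open>The pentagonal number theorem\<close>

definition pent :: "int \<Rightarrow> nat" where
  "pent k = nat (k * (3 * k + 1) div 2)"

text \<open>Completing the square links the exponents in Euler's series to squares of integers
  congruent to 1 modulo 6.\<close>

lemma pent_eq: "24 * int (pent k) + 1 = (6 * k + 1)\<^sup>2"
proof -
  have "even (k * (3 * k + 1))" by auto
  moreover have "k * (3 * k + 1) \<ge> 0"
    by (cases "k \<ge> 0") (auto simp: mult_nonpos_nonpos)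
  ultimately have "2 * int (pent k) = k * (3 * k + 1)" unfolding pent_def by auto
  thus ?thesis by (simp add: power2_eq_square algebra_simps)
qed

definition tri :: "nat \<Rightarrow> nat" where "tri s = s * (s + 1) div 2"

lemma tri_Suc [simp]: "tri (Suc s) = tri s + Suc s"
  by (simp add: tri_def)

lemma pent_pos: "pent (int s) = s * s + tri s" 
proof -
  have "24 * int (pent (int s)) = 24 * int (s * s + tri s)"
  proof -
    have "2 * tri s = s * (s + 1)" by (simp add: tri_def)
    hence "2 * int (tri s) = int s * (int s + 1)" by (metis of_nat_mult of_nat_add of_nat_1 of_nat_numeral)
    thus ?thesis using pent_eq[of "int s"] by (simp add: power2_eq_square algebra_simps)
  qed
  thus ?thesis by (simp only: mult_cancel_left of_nat_eq_iff) simp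
qed

lemma pent_neg: "pent (- int (Suc s)) = Suc s * s + tri (Suc s)" 
proof -
  have "24 * int (pent (- int (Suc s))) = 24 * int (Suc s * s + tri (Suc s))"
  proof -
    have "2 * tri s = s * (s + 1)" by (simp add: tri_def)
    hence "2 * int (tri s) = int s * (int s + 1)" by (metis of_nat_mult of_nat_add of_nat_1 of_nat_numeral)
    thus ?thesis using pent_eq[of "- int (Suc s)"] by (simp add: power2_eq_square algebra_simps)
  qed
  thus ?thesis by (simp only: mult_cancel_left of_nat_eq_iff) simp
qed

text \<open>Shanks' finite form of the pentagonal number theorem: only the term \<open>s = 0\<close>
  on the right is not divisible by \<open>q ^ Suc n\<close>.\<close>

lemma shanks:
  fixes q :: "'a :: comm_ring_1"
  shows "1 + (\<Sum>s<n. (-1) ^ Suc s * (q ^ pent (int (Suc s)) + q ^ pent (- int (Suc s)))) =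
    (\<Sum>s\<le>n. (-1) ^ s * (\<Prod>k\<in>{s<..n}. 1 - q ^ k) * q ^ (s * n + tri s))"
proof (induction n)
  case 0
  show ?case by (simp add: tri_def)
next
  case (Suc n)
  define P where "P = (\<lambda>s n. \<Prod>k\<in>{s<..n}. 1 - q ^ k)"
  have PSuc: "P s (Suc n) = P s n * (1 - q ^ Suc n)" if "s \<le> n" for s
  proof -
    have "{s<..Suc n} = insert (Suc n) {s<..n}" using that by auto
    thus ?thesis by (simp add: P_def mult.commute)
  qed
  have PS: "P s n = P (Suc s) n * (1 - q ^ Suc s)" if "s < n" for s
  proof -
    have "{s<..n} = insert (Suc s) {Suc s<..n}" using that by auto
    thus ?thesis by (simp add: P_def mult.commute)
  qed
  define T where "T = (\<lambda>s. (-1) ^ s * P s n * q ^ (s * n + tri s))"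
  define V where "V = (\<lambda>s. (-1) ^ s * P s (Suc n) * q ^ (s * Suc n + tri s))"
  \<comment> \<open>\<open>W\<close> makes the sum telescope: passing from \<open>n\<close> to
    \<open>Suc n\<close> changes the summand \<open>T s\<close> by \<open>W (Suc s) - W s\<close>.
    The value at 0 is set separately because \<open>s - 1\<close> truncates there.\<close>
  define W where "W = (\<lambda>s. if s = 0 then 0 else (-1) ^ s * P (s - 1) n * q ^ (s * n + tri s))"
  have step: "V s - T s = W (Suc s) - W s" if "s \<le> n" for s
  proof (cases s)
    case 0
    thus ?thesis by (simp add: V_def T_def W_def PSuc tri_def algebra_simps)
  next
    case (Suc t)
    have Pt: "P t n = P (Suc t) n * (1 - q * q ^ t)" using PS[of t] that Suc by simp
    show ?thesis unfolding V_def T_def W_def using that Suc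
      by (simp add: PSuc Pt algebra_simps power_add)
  qed
  have "(\<Sum>s\<le>Suc n. V s) - (\<Sum>s\<le>n. T s) = V (Suc n) + (\<Sum>s\<le>n. V s - T s)"
    by (simp add: sum_subtractf)
  also have "(\<Sum>s\<le>n. V s - T s) = (\<Sum>s\<le>n. W (Suc s) - W s)"
    by (rule sum.cong) (auto simp: step)
  also have "\<dots> = W (Suc n) - W 0" by (rule sum_lessThan_telescope[of W "Suc n", unfolded lessThan_Suc_atMost])
  also have "V (Suc n) + \<dots> = (-1) ^ Suc n * (q ^ pent (int (Suc n)) + q ^ pent (- int (Suc n)))"
    unfolding pent_pos pent_neg by (simp add: V_def W_def P_def algebra_simps)
  finally show ?case using Suc unfolding V_def T_def P_def by (simp add: algebra_simps)
qed

definition psign :: "int \<Rightarrow> complex" where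
  "psign k = (if even k then 1 else -1)"

lemma psign_add: "psign (j + k) = psign j * psign k"
  by (simp add: psign_def)

lemma psign_of_nat [simp]: "psign (int n) = (-1) ^ n" "psign (- int n) = (-1) ^ n"
  by (simp_all add: psign_def)

lemma norm_psign [simp]: "norm (psign k) = 1"
  by (simp add: psign_def)

text \<open>Let \<open>n\<close> tend to infinity in \<open>shanks\<close>: the term
  \<open>s = 0\<close> tends to the infinite product, and each of the other \<open>n\<close> terms
  has norm at most \<open>C * r ^ n\<close>.\<close>

lemma euler_pentagonal_sums:
  fixes q :: complex
  assumes q: "norm q < 1"
  shows "(\<lambda>s. (-1) ^ Suc s * (q ^ pent (int (Suc s)) + q ^ pent (- int (Suc s)))) sums
    ((\<Prod>n. 1 - q ^ Suc n) - 1)"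
proof -
  define r where "r = norm q"
  have r: "0 \<le> r" "r < 1" using q by (auto simp: r_def)
  define P where "P = (\<lambda>s n. \<Prod>k\<in>{s<..n}. 1 - q ^ k)"
  have summ: "summable (\<lambda>n. norm (1 - q ^ Suc n - 1))"
    using r summable_geometric[of r] by (simp add: norm_power norm_mult summable_mult r_def)
  hence "convergent_prod (\<lambda>n. 1 - q ^ Suc n)"
    by (intro abs_convergent_prod_imp_convergent_prod summable_imp_abs_convergent_prod)
  hence "(\<lambda>N. \<Prod>n\<le>N. 1 - q ^ Suc n) \<longlonglongrightarrow> (\<Prod>n. 1 - q ^ Suc n)"
    by (rule convergent_prod_LIMSEQ)
  moreover have "(\<Prod>n\<le>N. 1 - q ^ Suc n) = P 0 (Suc N)" for N
    unfolding P_def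
    by (rule prod.reindex_bij_witness[of _ "\<lambda>k. k - 1" Suc]) auto
  ultimately have limP: "(\<lambda>n. P 0 n) \<longlonglongrightarrow> (\<Prod>n. 1 - q ^ Suc n)"
    using filterlim_sequentially_Suc[of "P 0"] by simp
  \<comment> \<open>By \<open>1 + x \<le> exp x\<close> and the geometric series, this bounds the
    norm of every \<open>P s n\<close>.\<close>
  define C where "C = exp (r / (1 - r))"
  have C0: "0 \<le> C" by (simp add: C_def)
  have bound: "norm (P s n) \<le> C" for s n
  proof -
    have "norm (P s n) \<le> (\<Prod>k\<in>{s<..n}. exp (r ^ k))"
      unfolding P_def prod_norm[symmetric]
    proof (rule prod_mono)
      fix k
      have "norm (1 - q ^ k) \<le> 1 + r ^ k"
        using norm_triangle_ineq4[of 1 "q ^ k"] by (simp add: norm_power r_def)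
      also have "\<dots> \<le> exp (r ^ k)" by (rule exp_ge_add_one_self)
      finally show "0 \<le> norm (1 - q ^ k) \<and> norm (1 - q ^ k) \<le> exp (r ^ k)" by simp
    qed
    also have "\<dots> = exp (\<Sum>k\<in>{s<..n}. r ^ k)" by (simp add: exp_sum)
    also have "(\<Sum>k\<in>{s<..n}. r ^ k) \<le> (\<Sum>k\<in>{0<..n}. r ^ k)"
      using r by (intro sum_mono2) auto
    also have "(\<Sum>k\<in>{0<..n}. r ^ k) = (\<Sum>k<n. r * r ^ k)"
      by (rule sum.reindex_bij_witness[of _ Suc "\<lambda>k. k - 1"]) (auto simp flip: power_Suc)
    also have "\<dots> \<le> (\<Sum>k. r * r ^ k)"
      using r by (intro sum_le_suminf summable_mult summable_geometric) auto
    also have "\<dots> = r / (1 - r)"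
      using r by (simp add: suminf_mult suminf_geometric summable_geometric)
    finally show ?thesis by (simp add: C_def)
  qed
  have "(\<lambda>n. \<Sum>s\<in>{0<..n}. (-1) ^ s * P s n * q ^ (s * n + tri s)) \<longlonglongrightarrow> 0"
  proof (rule Lim_null_comparison)
    show "(\<lambda>n. C * (of_nat n * r ^ n)) \<longlonglongrightarrow> 0"
      using r by (intro tendsto_mult_right_zero powser_times_n_limit_0) auto
    show "\<forall>\<^sub>F n in sequentially. norm (\<Sum>s\<in>{0<..n}. (-1) ^ s * P s n * q ^ (s * n + tri s)) \<le> C * (of_nat n * r ^ n)"
    proof (rule always_eventually, rule allI)
      fix n
      have "norm (\<Sum>s\<in>{0<..n}. (-1) ^ s * P s n * q ^ (s * n + tri s)) \<le> (\<Sum>s\<in>{0<..n}. C * r ^ n)"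
      proof (rule sum_norm_le)
        fix s assume "s \<in> {0<..n}"
        hence "n \<le> s * n + tri s" by (cases s) auto
        hence "r ^ (s * n + tri s) \<le> r ^ n" using r by (intro power_decreasing) auto
        thus "norm ((-1) ^ s * P s n * q ^ (s * n + tri s)) \<le> C * r ^ n"
          using bound[of s n] r C0 by (auto simp: norm_mult norm_power r_def[symmetric] intro!: mult_mono)
      qed
      thus "norm (\<Sum>s\<in>{0<..n}. (-1) ^ s * P s n * q ^ (s * n + tri s)) \<le> C * (of_nat n * r ^ n)"
        by (simp add: mult_ac)
    qed
  qed
  from tendsto_add[OF limP this]
  have "(\<lambda>n. P 0 n + (\<Sum>s\<in>{0<..n}. (-1) ^ s * P s n * q ^ (s * n + tri s))) \<longlonglongrightarrow> (\<Prod>n. 1 - q ^ Suc n)"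
    by simp
  moreover have "P 0 n + (\<Sum>s\<in>{0<..n}. (-1) ^ s * P s n * q ^ (s * n + tri s)) =
    1 + (\<Sum>s<n. (-1) ^ Suc s * (q ^ pent (int (Suc s)) + q ^ pent (- int (Suc s))))" for n
  proof -
    have "{..n} = insert 0 {0<..n}" by auto
    thus ?thesis unfolding shanks P_def by (simp add: tri_def)
  qed
  ultimately have "(\<lambda>n. 1 + (\<Sum>s<n. (-1) ^ Suc s * (q ^ pent (int (Suc s)) + q ^ pent (- int (Suc s)))))
    \<longlonglongrightarrow> (\<Prod>n. 1 - q ^ Suc n)" by simp
  from tendsto_diff[OF this tendsto_const[of 1]] show ?thesis
    unfolding sums_def by simp
qed

text \<open>The paired terms are separated into a sum over all integers; absolute convergence is
  recorded so that the fourth power can be expanded.\<close>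

theorem euler_pentagonal:
  fixes q :: complex
  assumes q: "norm q < 1"
  shows "((\<lambda>k. psign k * q ^ pent k) has_sum (\<Prod>n. 1 - q ^ Suc n)) UNIV"
    and "(\<lambda>k. norm (psign k * q ^ pent k)) summable_on UNIV"
proof -
  define f where "f = (\<lambda>k. psign k * q ^ pent k)"
  have U: "UNIV = {0} \<union> (range (\<lambda>s. int (Suc s)) \<union> range (\<lambda>s. - int (Suc s)))"
  proof (intro equalityI subsetI UNIV_I)
    fix k :: int
    show "k \<in> {0} \<union> (range (\<lambda>s. int (Suc s)) \<union> range (\<lambda>s. - int (Suc s)))"
    proof (cases k rule: int_cases3)
      case (pos n)
      hence "k = int (Suc (n - 1))" by simp
      thus ?thesis by blast
    next
      case (neg n)
      hence "k = - int (Suc (n - 1))" by simp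
      thus ?thesis by blast
    qed simp
  qed
  have inj: "inj (\<lambda>s. int (Suc s))" "inj (\<lambda>s. - int (Suc s))" by (auto intro!: injI)
  have summ: "summable (\<lambda>s. norm (f (int (Suc s))))" "summable (\<lambda>s. norm (f (- int (Suc s))))"
  proof -
    have geo: "summable (\<lambda>s. norm q ^ s)" using q by (intro summable_geometric) simp
    have "norm (norm (f (int (Suc s)))) \<le> norm q ^ s" "norm (norm (f (- int (Suc s)))) \<le> norm q ^ s" for s
      by (simp_all only: f_def pent_pos pent_neg real_norm_def abs_norm_cancel power_abs norm_mult norm_psign norm_power mult_1_left)
        (intro power_decreasing; use q in simp)+
    thus "summable (\<lambda>s. norm (f (int (Suc s))))" "summable (\<lambda>s. norm (f (- int (Suc s))))"
      by (auto intro: summable_comparison_test'[OF geo])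
  qed
  have hs: "(g has_sum (g 0 + (suminf (\<lambda>s. g (int (Suc s))) + suminf (\<lambda>s. g (- int (Suc s)))))) UNIV"
    if "summable (\<lambda>s. norm (g (int (Suc s))))" "summable (\<lambda>s. norm (g (- int (Suc s))))"
    for g :: "int \<Rightarrow> 'b :: banach"
  proof -
    have "((\<lambda>s. g (int (Suc s))) has_sum suminf (\<lambda>s. g (int (Suc s)))) UNIV"
         "((\<lambda>s. g (- int (Suc s))) has_sum suminf (\<lambda>s. g (- int (Suc s)))) UNIV"
      by (intro norm_summable_imp_has_sum summable_sums that that[THEN summable_norm_cancel])+
    hence 1: "(g has_sum suminf (\<lambda>s. g (int (Suc s)))) (range (\<lambda>s. int (Suc s)))"
      "(g has_sum suminf (\<lambda>s. g (- int (Suc s)))) (range (\<lambda>s. - int (Suc s)))"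
      unfolding has_sum_reindex[OF inj(1)] has_sum_reindex[OF inj(2)] o_def .
    show ?thesis unfolding U
      by (intro has_sum_Un_disjoint 1) (auto intro: has_sum_finiteI)
  qed
  have "(\<lambda>s. f (int (Suc s)) + f (- int (Suc s))) sums (suminf (\<lambda>s. f (int (Suc s))) + suminf (\<lambda>s. f (- int (Suc s))))"
    by (intro sums_add summable_sums summ[THEN summable_norm_cancel])
  moreover have "(\<lambda>s. f (int (Suc s)) + f (- int (Suc s))) sums ((\<Prod>n. 1 - q ^ Suc n) - 1)"
    using euler_pentagonal_sums[OF q]
    by (simp only: f_def psign_of_nat distrib_left)
  ultimately have "suminf (\<lambda>s. f (int (Suc s))) + suminf (\<lambda>s. f (- int (Suc s))) = (\<Prod>n. 1 - q ^ Suc n) - 1"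
    by (rule sums_unique2)
  moreover have "f 0 = 1" by (simp add: f_def psign_def pent_def)
  ultimately show "((\<lambda>k. psign k * q ^ pent k) has_sum (\<Prod>n. 1 - q ^ Suc n)) UNIV"
    using hs[OF summ] by (simp add: f_def)
  have "((\<lambda>k. norm (f k)) has_sum (norm (f 0) + (suminf (\<lambda>s. norm (f (int (Suc s)))) + suminf (\<lambda>s. norm (f (- int (Suc s))))))) UNIV"
    using hs[of "\<lambda>k. norm (f k)"] summ by simp
  thus "(\<lambda>k. norm (psign k * q ^ pent k)) summable_on UNIV"
    unfolding f_def summable_on_def by blast
qed

text \<open>The second conclusion has the form of the hypotheses, so the product can be
  iterated.\<close>

lemma has_sum_product:
  fixes f :: "'a \<Rightarrow> complex" and g :: "'b \<Rightarrow> complex"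
  assumes f: "(f has_sum a) A" "(\<lambda>x. norm (f x)) summable_on A" and g: "(g has_sum b) B" "(\<lambda>y. norm (g y)) summable_on B"
  shows "((\<lambda>(x, y). f x * g y) has_sum (a * b)) (A \<times> B)"
    and "(\<lambda>z. norm (case z of (x, y) \<Rightarrow> f x * g y)) summable_on A \<times> B"
proof -
  show abs: "(\<lambda>z. norm (case z of (x, y) \<Rightarrow> f x * g y)) summable_on A \<times> B"
    unfolding Infinite_Sum.abs_summable_on_Sigma_iff
    using f(2) g(2)
    by (auto simp: norm_mult abs_mult infsum_cmult_right' intro!: summable_on_cmult_right summable_on_cmult_left)
  show "((\<lambda>(x, y). f x * g y) has_sum (a * b)) (A \<times> B)"
  proof (rule has_sum_SigmaI)
    show "((\<lambda>y. case (x, y) of (x, y) \<Rightarrow> f x * g y) has_sum f x * b) B" for x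
      using has_sum_cmult_right[OF g(1)] by simp
    show "((\<lambda>x. f x * b) has_sum a * b) A"
      using f(1) by (rule has_sum_cmult_left)
    show "(\<lambda>(x, y). f x * g y) summable_on A \<times> B"
      using abs by (rule abs_summable_summable)
  qed
qed

section \<open>The coefficients of the cusp form as signed counts\<close>

definition pent_quads :: "nat \<Rightarrow> (int \<times> int \<times> int \<times> int) set" where
  "pent_quads n = {(a, b, c, d). 1 + 6 * (pent a + pent b + pent c + pent d) = n}"

lemma pent_ge: "\<bar>k\<bar> \<le> int (pent k)"
proof -
  have "24 * \<bar>k\<bar> + 1 \<le> (6 * k + 1)\<^sup>2"
  proof (cases "k \<ge> 0")
    case True
    have "k * k \<ge> k" using True by (cases "k = 0") (auto simp: mult_le_cancel_left1)
    thus ?thesis using True by (simp add: power2_eq_square algebra_simps)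
  next
    case False
    have "(k + 1) * k \<ge> 0" using False by (intro mult_nonpos_nonpos) auto
    thus ?thesis using False by (simp add: power2_eq_square algebra_simps)
  qed
  thus ?thesis using pent_eq[of k] by linarith
qed

lemma finite_pent_quads: "finite (pent_quads n)"
proof (rule finite_subset)
  let ?I = "{- int n..int n}"
  show "pent_quads n \<subseteq> ?I \<times> ?I \<times> ?I \<times> ?I"
  proof
    fix x assume "x \<in> pent_quads n"
    then obtain a b c d where x: "x = (a, b, c, d)" and n: "1 + 6 * (pent a + pent b + pent c + pent d) = n"
      by (auto simp: pent_quads_def)
    have "\<bar>a\<bar> \<le> int n \<and> \<bar>b\<bar> \<le> int n \<and> \<bar>c\<bar> \<le> int n \<and> \<bar>d\<bar> \<le> int n"
      unfolding n[symmetric] by (intro conjI order_trans[OF pent_ge]) simp_all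
    thus "x \<in> ?I \<times> ?I \<times> ?I \<times> ?I" by (simp add: x abs_le_iff)
  qed
qed simp

text \<open>The four exponential prefactors multiply to \<open>z\<close>, and the remaining factor
  is the fourth power of Euler's product at \<open>q = z ^ 6\<close>. Four pentagonal series are
  multiplied and the quadruples grouped by the exponent of \<open>z\<close>.\<close>

lemma eta6_power_sums:
  assumes "Im \<tau> > 0"
  shows "(\<lambda>n. (\<Sum>(a, b, c, d)\<in>pent_quads n. psign (a + b + c + d)) * qpar \<tau> ^ n) sums
    (dedekind_eta (6 * \<tau>) ^ 4)"
proof -
  define z where "z = qpar \<tau>"
  define q where "q = z ^ 6"
  define P where "P = (\<Prod>n. 1 - q ^ Suc n)"
  have "norm z < 1" using assms by (simp add: z_def qpar_def)
  hence q: "norm q < 1" by (simp add: q_def norm_power power_less_one_iff)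
  have eta: "dedekind_eta (6 * \<tau>) ^ 4 = z * (P * (P * (P * P)))"
  proof -
    have "qpar (6 * \<tau>) = q"
      unfolding qpar_def q_def z_def by (subst exp_of_nat_mult[symmetric]) (simp add: mult_ac)
    moreover have "exp (2 * of_real pi * \<i> * (6 * \<tau>) / 24) ^ 4 = z"
      unfolding qpar_def z_def by (subst exp_of_nat_mult[symmetric]) (simp add: mult_ac)
    ultimately show ?thesis
      by (simp add: dedekind_eta_def power_mult_distrib P_def power4_eq_xxxx mult_ac)
  qed
  let ?f = "\<lambda>k. psign k * q ^ pent k"
  note e = euler_pentagonal[OF q, folded P_def]
  note e2 = has_sum_product[OF e e]
  note e3 = has_sum_product[OF e e2]
  note e4 = has_sum_product[OF e e3]
  define h where "h = (\<lambda>(a, b, c, d). psign (a + b + c + d) * z ^ (1 + 6 * (pent a + pent b + pent c + pent d)))"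
  have "((\<lambda>x. z * (case x of (a, b, c, d) \<Rightarrow> ?f a * (?f b * (?f c * ?f d)))) has_sum z * (P * (P * (P * P)))) UNIV"
    using has_sum_cmult_right[OF e4(1), of z] by (simp add: case_prod_unfold)
  also have "(\<lambda>x. z * (case x of (a, b, c, d) \<Rightarrow> ?f a * (?f b * (?f c * ?f d)))) = h"
    by (auto simp: h_def fun_eq_iff psign_add power_add distrib_left q_def mult_ac simp flip: power_mult)
  finally have h: "(h has_sum dedekind_eta (6 * \<tau>) ^ 4) UNIV" unfolding eta .
  have inj: "inj_on snd (Sigma UNIV pent_quads)"
    by (auto simp: inj_on_def pent_quads_def)
  have img: "snd ` Sigma UNIV pent_quads = UNIV"
    by (force simp: pent_quads_def image_iff)
  have "((\<lambda>p. h (snd p)) has_sum dedekind_eta (6 * \<tau>) ^ 4) (Sigma UNIV pent_quads)"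
    using h has_sum_reindex[OF inj, of h] by (simp add: img o_def)
  hence "((\<lambda>n. \<Sum>x\<in>pent_quads n. h x) has_sum dedekind_eta (6 * \<tau>) ^ 4) UNIV"
    by (rule has_sum_SigmaD) (auto intro!: has_sum_finiteI finite_pent_quads)
  moreover have "(\<Sum>x\<in>pent_quads n. h x) = (\<Sum>(a, b, c, d)\<in>pent_quads n. psign (a + b + c + d)) * z ^ n" for n
    unfolding sum_distrib_right
    by (rule sum.cong) (auto simp: h_def pent_quads_def)
  ultimately show ?thesis using has_sum_imp_sums by (simp add: z_def)
qed

lemma eta6_coeff_eq: "eta6_coeff n = (\<Sum>(a, b, c, d)\<in>pent_quads n. psign (a + b + c + d))"
proof -
  have "has_q_expansion (\<lambda>\<tau>. dedekind_eta (6 * \<tau>) ^ 4)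
    (\<lambda>n. \<Sum>(a, b, c, d)\<in>pent_quads n. psign (a + b + c + d))"
    unfolding has_q_expansion_def using eta6_power_sums by blast
  thus ?thesis unfolding eta6_coeff_def by (metis has_q_expansion_fourier_coeff)
qed

subsection \<open>The three counts in terms of Hurwitz quaternions\<close>

text \<open>Integer vectors are Lipschitz quaternions, which at odd norm form class 0; coordinates
  congruent to 1 give the residue \<open>1 + i + j + k = 2 * \<omega>\<close>.\<close>

lemma r13_eq_card_hset:
  assumes "odd n"
  shows "r13 n = card (hset (int n) 2 1)"
proof -
  define f where "f = (\<lambda>x :: int ^ 4. Hur (x $ 1 - x $ 4) (x $ 2 - x $ 4) (x $ 3 - x $ 4) (2 * x $ 4))"
  define g where "g = (\<lambda>y. \<chi> i :: 4. if i = 4 then hw y div 2 else if i = 1 then h1 y + hw y div 2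
    else if i = 2 then hi y + hw y div 2 else hj y + hw y div 2)"
  have g: "g (Hur a b c d) $ 1 = a + d div 2" "g (Hur a b c d) $ 2 = b + d div 2"
    "g (Hur a b c d) $ 3 = c + d div 2" "g (Hur a b c d) $ 4 = d div 2" for a b c d
    by (simp_all add: g_def)
  have N: "hnorm (f x) = (\<Sum>i\<in>UNIV. (x $ i)\<^sup>2)" for x
    unfolding f_def hnorm_hur sum_4 by (simp add: power2_eq_square algebra_simps)
  have C: "hcong (f x) (Hur 0 0 0 2) \<longleftrightarrow> (\<forall>i. [x $ i = 1] (mod 3))" for x
  proof -
    have "3 dvd p - s \<and> 3 dvd q - s \<and> 3 dvd r - s \<and> 3 dvd 2 * s - 2 \<longleftrightarrow>
      3 dvd p - 1 \<and> 3 dvd q - 1 \<and> 3 dvd r - 1 \<and> 3 dvd s - 1" for p q r s :: int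
      by presburger
    thus ?thesis by (simp add: f_def hcong_hur forall_4 cong_iff_dvd_diff)
  qed
  have fg: "f (g y) = y" if "hcls y = 0" for y
  proof (cases y)
    case (Hur a b c d)
    have "even d" using that by (auto simp: Hur hcls_def split: if_splits)
    thus ?thesis unfolding Hur f_def g by simp
  qed
  have gf: "g (f x) = x" for x
    by (simp add: vec_eq_iff forall_4 f_def g)
  let ?X = "{x :: int ^ 4. (\<Sum>i\<in>UNIV. (x $ i)\<^sup>2) = int n \<and> (\<forall>i. [x $ i = 1] (mod 3))}"
  have "bij_betw f ?X (hset (int n) 0 (Hur 0 0 0 2))"
  proof (rule bij_betw_byWitness[where f' = g])
    show "f ` ?X \<subseteq> hset (int n) 0 (Hur 0 0 0 2)"
      by (auto simp: hset_def N C) (simp add: f_def hcls_def)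
    show "g ` hset (int n) 0 (Hur 0 0 0 2) \<subseteq> ?X"
    proof clarify
      fix y assume "y \<in> hset (int n) 0 (Hur 0 0 0 2)"
      thus "(\<Sum>i\<in>UNIV. (g y $ i)\<^sup>2) = int n \<and> (\<forall>i. [g y $ i = 1] (mod 3))"
        unfolding N[symmetric] C[symmetric] by (simp add: hset_def fg)
    qed
  qed (auto simp: gf fg hset_def)
  hence "r13 n = card (hset (int n) 0 (Hur 0 0 0 2))"
    unfolding r13_def by (rule bij_betw_same_card)
  \<comment> \<open>As \<open>\<omega> * (\<omega> - 1) = -1\<close>, the unit
    \<open>\<omega> - 1\<close> moves the residue \<open>2 * \<omega>\<close> to -2, which is 1
    modulo 3, and class 0 to class 2.\<close>
  also have "\<dots> = card (hset (int n) ((0 + hcls (Hur (-1) 0 0 1)) mod 3) (Hur 0 0 0 2 * Hur (-1) 0 0 1))"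
    using assms by (intro card_hset_mult_unit) (simp_all add: hnorm_hur)
  also have "Hur 0 0 0 2 * Hur (-1) 0 0 1 = Hur (-2) 0 0 0"
    by (simp add: times_hurwitz_def)
  also have "(0 + hcls (Hur (-1) 0 0 1)) mod 3 = 2" by (simp add: hcls_def)
  also have "hset (int n) 2 (Hur (-2) 0 0 0) = hset (int n) 2 1"
    by (rule hset_cong) (simp add: one_hurwitz_def hcong_hur)
  finally show ?thesis .
qed

text \<open>\<open>f\<close> builds the quaternion with doubled coordinates \<open>6 * a + 1\<close>
  to \<open>6 * d + 1\<close>. It is congruent to \<omega> modulo 3, and the parity of
  \<open>a + b + c + d\<close> selects class 1 or 2.\<close>

lemma card_pent_quads:
  assumes n: "odd n" and i: "i < 2"
  shows "card {(a, b, c, d) \<in> pent_quads n. (a + b + c + d) mod 2 = int i} = card (hset (int n) i 1)"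
proof -
  define f where "f = (\<lambda>(a, b, c, d). Hur (3 * (a - d)) (3 * (b - d)) (3 * (c - d)) (1 + 6 * d))"
  define g where "g = (\<lambda>y. let d = (hw y - 1) div 6 in (h1 y div 3 + d, hi y div 3 + d, hj y div 3 + d, d))"
  let ?X = "{(a, b, c, d) \<in> pent_quads n. (a + b + c + d) mod 2 = int i}"
  have N: "hnorm (f (a, b, c, d)) = int n \<longleftrightarrow> (a, b, c, d) \<in> pent_quads n" for a b c d
  proof -
    have "4 * hnorm (f (a, b, c, d)) = (6 * a + 1)\<^sup>2 + (6 * b + 1)\<^sup>2 + (6 * c + 1)\<^sup>2 + (6 * d + 1)\<^sup>2"
      unfolding f_def prod.case hnorm_hur4 by (simp add: algebra_simps)
    also have "\<dots> = 4 * int (1 + 6 * (pent a + pent b + pent c + pent d))"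
      by (simp flip: pent_eq)
    finally have "hnorm (f (a, b, c, d)) = int (1 + 6 * (pent a + pent b + pent c + pent d))" by simp
    thus ?thesis by (simp only: of_nat_eq_iff pent_quads_def mem_Collect_eq prod.case)
  qed
  have cls: "hcls (f (a, b, c, d)) = Suc i \<longleftrightarrow> (a + b + c + d) mod 2 = int i" for a b c d
  proof -
    define S where "S = a + b + c + d"
    have ev: "even (3 * (a - d) + 3 * (b - d) + 3 * (c - d)) \<longleftrightarrow> even S"
      unfolding S_def by presburger
    have "hcls (f (a, b, c, d)) = (if even S then 1 else 2)"
      by (simp only: f_def prod.case hcls_def hurwitz.sel ev) simp
    moreover have "S mod 2 = (if even S then 0 else 1)" by presburger
    moreover have "i = 0 \<or> i = 1" using i by linarith
    ultimately show ?thesis unfolding S_def[symmetric] by (cases "even S") auto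
  qed
  have cong: "hcong (f (a, b, c, d)) (Hur 0 0 0 1)" for a b c d
    by (simp add: f_def hcong_hur)
  have fg: "f (g y) = y" if y: "hcong y (Hur 0 0 0 1)" "hcls y \<noteq> 0" for y
  proof (cases y)
    case (Hur a b c d)
    have "3 dvd a" "3 dvd b" "3 dvd c" "3 dvd d - 1" "odd d"
      using y by (auto simp: Hur hcong_hur hcls_def split: if_splits)
    moreover from this have "6 dvd d - 1" by presburger
    ultimately show ?thesis by (simp add: Hur f_def g_def Let_def)
  qed
  have gf: "g (f x) = x" for x
    by (cases x) (simp add: f_def g_def)
  have "bij_betw f ?X (hset (int n) (Suc i) (Hur 0 0 0 1))"
  proof (rule bij_betw_byWitness[where f' = g])
    show "f ` ?X \<subseteq> hset (int n) (Suc i) (Hur 0 0 0 1)"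
      by (auto simp: hset_def N cls cong)
    show "g ` hset (int n) (Suc i) (Hur 0 0 0 1) \<subseteq> ?X"
    proof (rule image_subsetI)
      fix y assume y: "y \<in> hset (int n) (Suc i) (Hur 0 0 0 1)"
      obtain a b c d where g: "g y = (a, b, c, d)" by (rule prod_cases4)
      have "f (a, b, c, d) = y" using fg[of y] y by (simp add: g[symmetric] hset_def)
      thus "g y \<in> ?X" using y N[of a b c d] cls[of a b c d] by (simp add: g hset_def)
    qed
  qed (auto simp: gf fg hset_def)
  hence "card ?X = card (hset (int n) (Suc i) (Hur 0 0 0 1))"
    by (rule bij_betw_same_card)
  \<comment> \<open>The unit \<open>1 - \<omega>\<close> is the inverse of \<omega>; it moves the
    residue to 1 and lowers the class by one.\<close>
  also have "\<dots> = card (hset (int n) ((Suc i + hcls (Hur 1 0 0 (-1))) mod 3) (Hur 0 0 0 1 * Hur 1 0 0 (-1)))"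
    using n i by (intro card_hset_mult_unit) (simp_all add: hnorm_hur)
  also have "Hur 0 0 0 1 * Hur 1 0 0 (-1) = 1"
    by (simp add: times_hurwitz_def one_hurwitz_def)
  also have "(Suc i + hcls (Hur 1 0 0 (-1))) mod 3 = i" using i by (simp add: hcls_def)
  finally show ?thesis .
qed

lemma eta6_coeff_eq_card_hset:
  assumes "odd n"
  shows "eta6_coeff n = of_nat (card (hset (int n) 0 1)) - of_nat (card (hset (int n) 1 1))"
proof -
  define X where "X = (\<lambda>i. {(a, b, c, d) \<in> pent_quads n. (a + b + c + d) mod 2 = int i})"
  have X: "finite (X i)" for i
    unfolding X_def by (rule finite_subset[OF _ finite_pent_quads[of n]]) auto
  have "pent_quads n = X 0 \<union> X 1" "X 0 \<inter> X 1 = {}"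
    by (auto simp: X_def odd_iff_mod_2_eq_one[symmetric])
  hence "eta6_coeff n = (\<Sum>(a, b, c, d)\<in>X 0. psign (a + b + c + d)) + (\<Sum>(a, b, c, d)\<in>X 1. psign (a + b + c + d))"
    unfolding eta6_coeff_eq using X by (simp add: sum.union_disjoint)
  also have "(\<Sum>(a, b, c, d)\<in>X 0. psign (a + b + c + d)) = (\<Sum>x\<in>X 0. 1)"
    by (rule sum.cong) (auto simp: X_def psign_def)
  also have "(\<Sum>(a, b, c, d)\<in>X 1. psign (a + b + c + d)) = (\<Sum>x\<in>X 1. -1)"
    by (rule sum.cong) (auto simp: X_def psign_def even_iff_mod_2_eq_zero simp del: even_add)
  also have "(\<Sum>x\<in>X 0. 1) + (\<Sum>x\<in>X 1. -1) = of_nat (card (X 0)) - (of_nat (card (X 1)) :: complex)"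
    by simp
  finally show ?thesis using card_pent_quads[OF assms, of 0] card_pent_quads[OF assms, of 1]
    by (simp add: X_def)
qed

text \<open>Doubled coordinates identify the quaternions of norm \<open>n\<close> and nonzero class
  with the representations of \<open>4 * n\<close> by four odd squares.
  \<open>card_odd_quads\<close> and \<open>card_nonzero_hcls\<close> both contribute a factor 16,
  which cancels.\<close>

lemma sigma1_eq_card_hset:
  assumes n: "odd n" "n mod 3 = 1"
  shows "sigma1 n = card (hset (int n) 0 1) + card (hset (int n) 1 1) + card (hset (int n) 2 1)"
proof -
  define f where "f = (\<lambda>(p, q, r, s). Hur ((p - s) div 2) ((q - s) div 2) ((r - s) div 2) s)"
  define g where "g = (\<lambda>y. (2 * h1 y + hw y, 2 * hi y + hw y, 2 * hj y + hw y, hw y))"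
  have gf: "g (f x) = x" if "x \<in> odd_quads m" for x m
    using that by (cases x) (auto simp: f_def g_def odd_quads_def)
  have fg: "f (g y) = y" for y by (cases y) (simp add: f_def g_def)
  have mem: "g y \<in> odd_quads (4 * int n) \<longleftrightarrow> y \<in> {x. hnorm x = int n \<and> hcls x \<noteq> 0}" for y
  proof (cases y)
    case (Hur a b c d)
    have "hnorm y = int n \<longleftrightarrow> 4 * hnorm y = 4 * int n" by simp
    also have "\<dots> \<longleftrightarrow> (2 * a + d)\<^sup>2 + (2 * b + d)\<^sup>2 + (2 * c + d)\<^sup>2 + d\<^sup>2 = 4 * int n"
      by (simp only: Hur hnorm_hur4)
    finally show ?thesis by (auto simp: Hur g_def odd_quads_def hcls_def)
  qed
  have "bij_betw g {x. hnorm x = int n \<and> hcls x \<noteq> 0} (odd_quads (4 * int n))"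
  proof (rule bij_betw_byWitness[where f' = f])
    show "f ` odd_quads (4 * int n) \<subseteq> {x. hnorm x = int n \<and> hcls x \<noteq> 0}"
      using mem gf by fastforce
  qed (use mem fg gf in auto)
  hence "16 * sigma1 n = card {x. hnorm x = int n \<and> hcls x \<noteq> 0}"
    using card_odd_quads[OF n(1)] bij_betw_same_card by metis
  also have "\<dots> = 16 * (card (hset (int n) 0 1) + card (hset (int n) 1 1) + card (hset (int n) 2 1))"
  proof (rule card_nonzero_hcls)
    show "odd (int n)" using n by simp
    have "int n mod int 3 = int 1" unfolding zmod_int[symmetric] n ..
    thus "int n mod 3 = 1" by simp
  qed
  finally show ?thesis by simp
qed


text \<open>By \<open>c\<^sub>1 = c\<^sub>2\<close>, \<open>sigma1\<close> and
  \<open>eta6_coeff\<close> are the values of the trivial and a nontrivial character of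
  \<open>Z/3\<close> on the group ring element with coefficients \<open>c\<^sub>j\<close>, and
  \<open>r13\<close> is its coefficient \<open>c\<^sub>1\<close>. Both formulas follow from the
  convolution in \<open>card_hset_mult\<close>.\<close>

lemma
  assumes m: "[m = 1] (mod 6)" and n: "[n = 1] (mod 6)" and cop: "coprime m n"
  shows r13_mult: "of_nat (r13 (m * n)) = of_nat (sigma1 n) * of_nat (r13 m) + eta6_coeff m * of_nat (r13 n)"
    and eta6_coeff_mult: "eta6_coeff (m * n) = eta6_coeff m * eta6_coeff n"
proof -
  define c where "c = (\<lambda>m i. card (hset (int m) i 1))"
  have res: "m mod 3 = 1 \<and> odd m \<and> m > 0" if "[m = 1] (mod 6)" for m :: nat
    using that unfolding cong_def by presburger
  note m' = res[OF m] and n' = res[OF n]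
  have m3: "int m mod 3 = 1"
  proof -
    have "int m mod int 3 = int 1" unfolding zmod_int[symmetric] using m' by simp
    thus ?thesis by simp
  qed
  have c12: "c k 1 = c k 2" if "odd k" for k
    unfolding c_def using that by (intro card_hset_conj) simp
  have cm: "c (m * n) j = (\<Sum>i<3. c m i * c n ((j + 3 - i) mod 3))" if "j < 3" for j
    unfolding c_def of_nat_mult using m' n' cop m3 that by (intro card_hset_mult) auto
  have sum3: "(\<Sum>i<3. f i) = f 0 + f 1 + f 2" for f :: "nat \<Rightarrow> nat"
    by (simp add: eval_nat_numeral)
  have c0: "c (m * n) 0 = c m 0 * c n 0 + c m 1 * c n 1 + c m 1 * c n 1"
    using cm[of 0] c12[of m] c12[of n] m' n' unfolding sum3 by simp
  have c1: "c (m * n) 1 = c m 0 * c n 1 + c m 1 * c n 0 + c m 1 * c n 1"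
    using cm[of 1] c12[of m] c12[of n] m' n' unfolding sum3 by simp
  have r: "r13 k = c k 1" if "odd k" for k
    using r13_eq_card_hset[OF that] c12[OF that] by (simp add: c_def)
  have e: "eta6_coeff k = of_nat (c k 0) - of_nat (c k 1)" if "odd k" for k
    using eta6_coeff_eq_card_hset[OF that] by (simp add: c_def)
  have s: "sigma1 n = c n 0 + 2 * c n 1"
    using sigma1_eq_card_hset[of n] n' c12[of n] by (simp add: c_def)
  have om: "odd m" and on: "odd n" and omn: "odd (m * n)" using m' n' by simp_all
  show "of_nat (r13 (m * n)) = of_nat (sigma1 n) * of_nat (r13 m) + eta6_coeff m * of_nat (r13 n)"
    unfolding r[OF om] r[OF on] r[OF omn] e[OF om] s c1 by (simp add: algebra_simps)
  show "eta6_coeff (m * n) = eta6_coeff m * eta6_coeff n"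
    unfolding e[OF om] e[OF on] e[OF omn] c0 c1 by (simp add: algebra_simps)
qed

subsection \<open>Products of prime powers\<close>

lemma eta6_coeff_1: "eta6_coeff 1 = 1"
proof -
  have "pent a = 0 \<longleftrightarrow> a = 0" for a
  proof
    assume "pent a = 0"
    thus "a = 0" using pent_ge[of a] by simp
  qed (simp add: pent_def)
  hence "pent_quads 1 = {(0, 0, 0, 0)}" by (auto simp: pent_quads_def)
  thus ?thesis by (simp add: eta6_coeff_eq psign_def)
qed

text \<open>At \<open>m = n = 1\<close> the product formula reads \<open>r = r + r\<close>; this
  settles the empty product.\<close>

lemma r13_1: "r13 1 = 0"
proof -
  have "of_nat (r13 (1 * 1)) = of_nat (sigma1 1) * of_nat (r13 1) + eta6_coeff 1 * of_nat (r13 1)"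
    by (rule r13_mult) simp_all
  thus ?thesis using eta6_coeff_1 by (simp add: sigma1_def)
qed

text \<open>Splitting off the last factor, \<open>r13_mult\<close> multiplies every earlier summand
  by its \<open>sigma1\<close> and adds one summand with \<open>eta6_coeff\<close> of the earlier
  product. The second conjunct expands that coefficient.\<close>

lemma r13_prod:
  fixes P :: "nat \<Rightarrow> nat"
  assumes "\<And>i. i \<in> {1..k} \<Longrightarrow> [P i = 1] (mod 6)"
    and "\<And>i j. i \<in> {1..k} \<Longrightarrow> j \<in> {1..k} \<Longrightarrow> i \<noteq> j \<Longrightarrow> coprime (P i) (P j)"
  shows "of_nat (r13 (\<Prod>i=1..k. P i)) =
      (\<Sum>i=1..k. (\<Prod>j=i+1..k. of_nat (sigma1 (P j))) * (\<Prod>j=1..<i. eta6_coeff (P j)) * of_nat (r13 (P i)))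
    \<and> eta6_coeff (\<Prod>i=1..k. P i) = (\<Prod>i=1..k. eta6_coeff (P i))"
  using assms
proof (induction k)
  case 0
  show ?case using r13_1 eta6_coeff_1 by simp
next
  case (Suc k)
  define N where "N = (\<Prod>i=1..k. P i)"
  have P: "[P i = 1] (mod 6)" if "i \<in> {1..k}" for i
    using that by (intro Suc.prems(1)) simp
  have cop: "coprime (P i) (P j)" if "i \<in> {1..k}" "j \<in> {1..k}" "i \<noteq> j" for i j
    using that by (intro Suc.prems(2)) simp_all
  have "of_nat (r13 N) =
      (\<Sum>i=1..k. (\<Prod>j=i+1..k. of_nat (sigma1 (P j))) * (\<Prod>j=1..<i. eta6_coeff (P j)) * of_nat (r13 (P i)))
    \<and> eta6_coeff N = (\<Prod>i=1..k. eta6_coeff (P i))"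
    unfolding N_def by (rule Suc.IH[OF P cop])
  note IH = this[THEN conjunct1] this[THEN conjunct2]
  have "[(\<Prod>i=1..k. P i) = (\<Prod>i=1..k. 1)] (mod 6)"
    by (intro cong_prod P)
  hence N: "[N = 1] (mod 6)" by (simp add: N_def)
  have P': "[P (Suc k) = 1] (mod 6)" by (rule Suc.prems(1)) simp
  have cop': "coprime N (P (Suc k))"
    unfolding N_def by (intro prod_coprime_left Suc.prems(2)) auto
  have prod: "(\<Prod>i=1..Suc k. P i) = N * P (Suc k)" by (simp add: N_def)
  have "of_nat (r13 (N * P (Suc k))) =
    of_nat (sigma1 (P (Suc k))) * of_nat (r13 N) + eta6_coeff N * of_nat (r13 (P (Suc k)))"
    by (rule r13_mult[OF N P' cop'])
  also have "\<dots> = (\<Sum>i=1..k. (\<Prod>j=i+1..Suc k. of_nat (sigma1 (P j))) * (\<Prod>j=1..<i. eta6_coeff (P j)) * of_nat (r13 (P i)))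
     + (\<Prod>j=1..<Suc k. eta6_coeff (P j)) * of_nat (r13 (P (Suc k)))"
    unfolding IH sum_distrib_left atLeastLessThanSuc_atLeastAtMost
    by (intro arg_cong2[of _ _ _ _ "(+)"] sum.cong refl) (simp add: mult_ac)
  finally show ?case
    unfolding prod eta6_coeff_mult[OF N P' cop'] IH(2) by simp
qed

theorem theorem9:
  fixes k n :: nat and p \<alpha> :: "nat \<Rightarrow> nat"
  assumes "\<And>i. i \<in> {1..k} \<Longrightarrow> prime (p i)"
    and "inj_on p {1..k}"
    and "\<And>i. i \<in> {1..k} \<Longrightarrow> \<alpha> i > 0"
    and "n = (\<Prod>i=1..k. p i ^ \<alpha> i)"
    and "[n = 1] (mod 6)"
    and "\<And>i. i \<in> {1..k} \<Longrightarrow> [p i = 5] (mod 6) \<Longrightarrow> even (\<alpha> i)"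
  shows "of_nat (r13 n) =
    (\<Sum>i=1..k. (\<Prod>j=i+1..k. of_nat (sigma1 (p j ^ \<alpha> j))) *
               (\<Prod>j=1..<i. eta6_coeff (p j ^ \<alpha> j)) *
               of_nat (r13 (p i ^ \<alpha> i)))"
proof -
  have n_res: "odd n \<and> n mod 3 = 1"
    using assms(5) unfolding cong_def by presburger
  \<comment> \<open>Since \<open>n\<close> is prime to 6, each \<open>p i\<close> is 1 or 5 modulo
    6, and in the second case the even exponent makes the power 1.\<close>
  have P: "[p i ^ \<alpha> i = 1] (mod 6)" if i: "i \<in> {1..k}" for i
  proof -
    have dvd: "p i dvd n"
    proof -
      have "p i dvd p i ^ \<alpha> i" using assms(3)[OF i] by simp
      also have "\<dots> dvd n" unfolding assms(4) using i by (intro dvd_prodI) simp_all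
      finally show ?thesis .
    qed
    have "odd (p i)" using dvd n_res by (metis dvd_trans)
    moreover have "p i mod 3 \<noteq> 0"
    proof
      assume "p i mod 3 = 0"
      hence "3 dvd n" using dvd by (metis dvd_trans mod_0_imp_dvd)
      thus False using n_res by simp
    qed
    ultimately have "p i mod 6 = 1 \<or> p i mod 6 = 5" by presburger
    thus ?thesis
    proof
      assume "p i mod 6 = 1"
      hence "[p i = 1] (mod 6)" by (simp add: cong_def)
      from cong_pow[OF this, of "\<alpha> i"] show ?thesis by simp
    next
      assume "p i mod 6 = 5"
      hence p5: "[p i = 5] (mod 6)" by (simp add: cong_def)
      then obtain m where m: "\<alpha> i = 2 * m" using assms(6)[OF i] by blast
      have "[(p i)\<^sup>2 = 5\<^sup>2] (mod 6)" using p5 by (rule cong_pow)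
      also have "[5\<^sup>2 = 1 :: nat] (mod 6)" by (simp add: cong_def)
      finally have "[(p i)\<^sup>2 = 1] (mod 6)" .
      from cong_pow[OF this, of m] show ?thesis by (simp add: m power_mult)
    qed
  qed
  have cop: "coprime (p i ^ \<alpha> i) (p j ^ \<alpha> j)" if "i \<in> {1..k}" "j \<in> {1..k}" "i \<noteq> j" for i j
  proof -
    have "p i \<noteq> p j" using inj_onD[OF assms(2)] that by blast
    hence "coprime (p i) (p j)" by (intro primes_coprime assms(1) that)
    thus ?thesis by simp
  qed
  show ?thesis
    unfolding assms(4) by (rule r13_prod[where P = "\<lambda>i. p i ^ \<alpha> i", THEN conjunct1, OF P cop])
qed

end
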